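(* Let $A$ be a unital $C^*$-algebra and let $a \in A$ be an element with closed range. Then $a$ is both a continuity point of $\mathbf{u}$ and an interior point of the domain of $\mathbf{u}$ (that is, there is $\epsilon > 0$ such that every $b \in A$ with $\|b - a\| < \epsilon$ has closed range) if and only if $a$ is quasi-invertible.
   Context: An element $a$ of a $C^*$-algebra $A$ has closed range if the spectrum of $a^*a$ is disjoint from the open interval $(0,\epsilon)$ for some $\epsilon > 0$ (equivalently, for any faithful representation $\pi$ of $A$ the operator $\pi(a)$ has closed range). For $a$ of closed range, $\mathbf{u}(a)$ denotes the partial isometry in its canonical polar decomposition: $a = \mathbf{u}(a)|a|$, where $|a| = (a^*a)^{1/2}$ and $\mathbf{u}(a)^*\mathbf{u}(a)$ is the right support projection of $a$ (the range projection of $a^*a$); it is well known that $\mathbf{u}(a)$ exists in $A$. The domain of $\mathbf{u}$ is the set of all closed range elements of $A$, with the norm topology, and continuity of $\mathbf{u}$ is as a map from this set to $A$ with the norm topology. An element $a$ of a unital $C^*$-algebra $A$ is quasi-invertible if $a$ has closed range and $\mathbf{u}(a)$ is an extreme point of the closed unit ball of $A$. (Kadison: a partial isometry $u$ in $A$ is an extreme point of the unit ball if and only if $(\mathbf{1}-uu^* )A(\mathbf{1}-u^*u) = \{0\}$. An equivalent condition for $a$ to be quasi-invertible is that there are closed two-sided ideals $I$ and $J$ of $A$ with $IJ = \{0\}$ such that the image of $a$ in $A/I$ is left invertible and the image of $a$ in $A/J$ is right invertible.) *)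

theory Defs
  imports "HOL-Analysis.Analysis"
begin

text \<open>
  Unital (complex) C*-algebras. The superclasses supply a complete, submultiplicative norm, the
  unit, and \<open>norm 1 = 1\<close> (so \<open>1 \<noteq> 0\<close>); the complex scalar multiplication extends the real one.
\<close>

class unital_cstar_algebra = real_normed_algebra_1 + complete_space +
  fixes scaleC :: "complex \<Rightarrow> 'a \<Rightarrow> 'a" (infixr "*\<^sub>C" 75)
    and adj :: "'a \<Rightarrow> 'a"
  assumes scaleC_add_right: "c *\<^sub>C (x + y) = c *\<^sub>C x + c *\<^sub>C y"
    and scaleC_add_left: "(c + d) *\<^sub>C x = c *\<^sub>C x + d *\<^sub>C x"
    and scaleC_scaleC: "c *\<^sub>C (d *\<^sub>C x) = (c * d) *\<^sub>C x"
    and scaleC_complex_of_real: "complex_of_real r *\<^sub>C x = scaleR r x"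
    and scaleC_mult_left: "(c *\<^sub>C x) * y = c *\<^sub>C (x * y)"
    and scaleC_mult_right: "x * (c *\<^sub>C y) = c *\<^sub>C (x * y)"
    and norm_scaleC: "norm (c *\<^sub>C x) = cmod c * norm x"
    and adj_adj: "adj (adj x) = x"
    and adj_add: "adj (x + y) = adj x + adj y"
    and adj_scaleC: "adj (c *\<^sub>C x) = cnj c *\<^sub>C adj x"
    and adj_mult: "adj (x * y) = adj y * adj x"
    and cstar_identity: "norm (adj x * x) = (norm x)\<^sup>2"

definition two_sided_invertible :: "'a::unital_cstar_algebra \<Rightarrow> bool" where
  "two_sided_invertible x \<longleftrightarrow> (\<exists>y. x * y = 1 \<and> y * x = 1)"

definition spectrum :: "'a::unital_cstar_algebra \<Rightarrow> complex set" where
  "spectrum x = {z. \<not> two_sided_invertible (z *\<^sub>C 1 - x)}"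

definition closed_range :: "'a::unital_cstar_algebra \<Rightarrow> bool" where
  "closed_range a \<longleftrightarrow>
     (\<exists>\<epsilon>>0. spectrum (adj a * a) \<inter> complex_of_real ` {0<..<\<epsilon>} = {})"

definition positive_element :: "'a::unital_cstar_algebra \<Rightarrow> bool" where
  "positive_element x \<longleftrightarrow> adj x = x \<and> spectrum x \<subseteq> complex_of_real ` {0..}"

definition abs_element :: "'a::unital_cstar_algebra \<Rightarrow> 'a" where
  "abs_element a = (THE h. positive_element h \<and> h * h = adj a * a)"

definition is_projection :: "'a::unital_cstar_algebra \<Rightarrow> bool" where
  "is_projection p \<longleftrightarrow> adj p = p \<and> p * p = p"

text \<open>
  The range projection of \<open>x\<close> is the least projection \<open>p\<close> with \<open>p * x = x\<close>; \<open>q * p = p\<close> expresses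
  \<open>p \<le> q\<close>. In general it lives only in the enveloping von Neumann algebra; for \<open>x = adj a * a\<close>
  with \<open>a\<close> of closed range it belongs to the algebra itself, and is then the least such projection
  of the algebra.
\<close>

definition is_range_projection :: "'a::unital_cstar_algebra \<Rightarrow> 'a \<Rightarrow> bool" where
  "is_range_projection p x \<longleftrightarrow>
     is_projection p \<and> p * x = x \<and> (\<forall>q. is_projection q \<and> q * x = x \<longrightarrow> q * p = p)"

text \<open>
  \<open>polar_part a\<close> is the partial isometry \<open>\<^bold>u(a)\<close> of the canonical polar decomposition. It is
  meaningful only for \<open>a\<close> of closed range.
\<close>

definition polar_part :: "'a::unital_cstar_algebra \<Rightarrow> 'a" where
  "polar_part a =
     (THE u. a = u * abs_element a \<and> is_range_projection (adj u * u) (adj a * a))"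

definition quasi_invertible :: "'a::unital_cstar_algebra \<Rightarrow> bool" where
  "quasi_invertible a \<longleftrightarrow> closed_range a \<and> polar_part a extreme_point_of cball 0 1"

end

theory Submission
  imports Defs
begin

text \<open>
  Write \<open>u\<close> for the polar part of \<open>a\<close>, \<open>p = u\<^sup>* u\<close> and \<open>q = u u\<^sup>*\<close>. By Kadison's criterion
  \<open>a\<close> is quasi-invertible iff the corner \<open>(1 - q) A (1 - p)\<close> vanishes. If it does, every \<open>b\<close> near
  \<open>a\<close> has, in block form, an invertible \<open>(q, p)\<close> entry with vanishing Schur complement; this gives
  a support projection \<open>p\<^sub>b\<close> of \<open>b\<close> depending continuously on \<open>b\<close>, and the polar part of \<open>b\<close> is
  \<open>b (|b| + 1 - p\<^sub>b)\<^sup>-\<^sup>1\<close>. If the corner contains \<open>y \<noteq> 0\<close>, the polar parts of \<open>a + t y\<close>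
  cannot converge to \<open>u\<close> as \<open>t\<close> decreases to \<open>0\<close>.

  The functional calculus is replaced by the power series of \<open>sqrt (1 - z)\<close>: the self-adjoint \<open>h\<close>
  with \<open>norm (s - h) \<le> s\<close> for some \<open>s > 0\<close> are exactly the squares of self-adjoint elements, because
  \<open>x + \<i> y\<close> is unitary for commuting self-adjoint \<open>x\<close>, \<open>y\<close> with \<open>x\<^sup>2 + y\<^sup>2 = 1\<close>.
\<close>

subclass (in unital_cstar_algebra) banach ..

section \<open>Elementary facts\<close>

lemma adj_0 [simp]: "adj (0::'a::unital_cstar_algebra) = 0"
  using adj_add[of "0::'a" 0] by simp

lemma adj_minus [simp]: "adj (- x) = - adj (x::'a::unital_cstar_algebra)"
proof -
  have "adj (- x) + adj x = 0"
    by (simp flip: adj_add)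
  then show ?thesis
    by (simp add: eq_neg_iff_add_eq_0)
qed

lemma adj_diff [simp]: "adj (x - y) = adj x - adj (y::'a::unital_cstar_algebra)"
  using adj_add[of x "- y"] by simp

lemma adj_1 [simp]: "adj (1::'a::unital_cstar_algebra) = 1"
  by (metis adj_adj adj_mult mult.left_neutral mult.right_neutral)

lemma adj_scaleR [simp]: "adj (r *\<^sub>R x) = r *\<^sub>R adj (x::'a::unital_cstar_algebra)"
  by (metis adj_scaleC complex_cnj_complex_of_real scaleC_complex_of_real)

lemma adj_of_real [simp]: "adj (of_real r) = (of_real r :: 'a::unital_cstar_algebra)"
  by (simp add: of_real_def)

lemmas adj_simps [simp] = adj_adj adj_add adj_mult adj_scaleC

lemma adj_power [simp]: "adj (x ^ n) = adj (x::'a::unital_cstar_algebra) ^ n"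
  by (induction n) (simp_all add: power_commutes)

text \<open>Dividing the C*-identity by \<open>norm y\<close> gives
  \<open>norm y <= norm (adj y)\<close>; apply this to \<open>x\<close> and to
  \<open>adj x\<close>.\<close>

lemma norm_adj [simp]: "norm (adj x) = norm (x::'a::unital_cstar_algebra)"
proof -
  have le: "norm y \<le> norm (adj y)" for y :: 'a
  proof (cases "y = 0")
    case False
    have "norm y * norm y \<le> norm (adj y) * norm y"
      using norm_mult_ineq[of "adj y" y] by (simp add: cstar_identity power2_eq_square)
    then show ?thesis
      using False by simp
  qed simp
  show ?thesis
    using le[of x] le[of "adj x"] by simp
qed

lemma bounded_linear_adj: "bounded_linear (adj :: 'a::unital_cstar_algebra \<Rightarrow> 'a)"
  by (rule bounded_linear_intro[where K = 1]) simp_all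

lemmas tendsto_adj [tendsto_intros] = bounded_linear.tendsto[OF bounded_linear_adj]

lemma adj_mult_self_eq_0 [simp]: "adj x * x = 0 \<longleftrightarrow> x = (0::'a::unital_cstar_algebra)"
  using cstar_identity[of x] by auto

lemma norm_self_adjoint_square:
  assumes "adj x = (x::'a::unital_cstar_algebra)"
  shows "norm (x * x) = (norm x)\<^sup>2"
  using cstar_identity[of x] assms by simp

lemma scaleC_minus_right: "c *\<^sub>C (- x) = - (c *\<^sub>C (x::'a::unital_cstar_algebra))"
proof -
  have "c *\<^sub>C (- x) + c *\<^sub>C x = 0"
    using norm_scaleC[of c "0::'a"] by (simp flip: scaleC_add_right)
  then show ?thesis
    by (simp add: eq_neg_iff_add_eq_0)
qed

lemma scaleC_diff_right: "c *\<^sub>C (x - y) = c *\<^sub>C x - c *\<^sub>C (y::'a::unital_cstar_algebra)"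
  using scaleC_add_right[of c x "- y"] by (simp add: scaleC_minus_right)

lemma scaleC_minus_left: "(- c) *\<^sub>C x = - (c *\<^sub>C (x::'a::unital_cstar_algebra))"
proof -
  have "(- c) *\<^sub>C x + c *\<^sub>C x = 0 *\<^sub>C x"
    by (simp flip: scaleC_add_left)
  also have "\<dots> = 0"
    using norm_scaleC[of 0 x] by simp
  finally show ?thesis
    by (simp add: eq_neg_iff_add_eq_0)
qed

lemma scaleC_one [simp]: "1 *\<^sub>C x = (x::'a::unital_cstar_algebra)"
  using scaleC_complex_of_real[of 1 x] by simp

lemma of_real_commute: "of_real r * x = x * (of_real r :: 'a::real_algebra_1)"
  by (simp add: of_real_def)

section \<open>Invertible elements\<close>

definition inv_elt :: "'a::unital_cstar_algebra \<Rightarrow> 'a" where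
  "inv_elt x = (SOME y. x * y = 1 \<and> y * x = 1)"

lemma inv_elt:
  assumes "two_sided_invertible x"
  shows "x * inv_elt x = 1" "inv_elt x * x = 1"
proof -
  have "x * inv_elt x = 1 \<and> inv_elt x * x = 1"
    unfolding inv_elt_def by (rule someI_ex) (use assms in \<open>simp add: two_sided_invertible_def\<close>)
  then show "x * inv_elt x = 1" "inv_elt x * x = 1" by auto
qed

lemma inv_elt_cancel:
  assumes "two_sided_invertible x"
  shows "x * (inv_elt x * y) = y" "inv_elt x * (x * y) = y"
  using inv_elt[OF assms] by (simp_all flip: mult.assoc)

lemma inv_elt_eqI:
  assumes "two_sided_invertible x" "y * x = 1"
  shows "inv_elt x = y"
  by (metis assms inv_elt(1) mult.assoc mult.left_neutral mult.right_neutral)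

lemma inv_elt_commute:
  assumes "two_sided_invertible x" "x * y = y * x"
  shows "inv_elt x * y = y * inv_elt x"
proof -
  have "inv_elt x * y = inv_elt x * (y * (x * inv_elt x))"
    by (simp add: inv_elt assms)
  also have "\<dots> = inv_elt x * (x * y) * inv_elt x"
    by (simp only: assms(2) mult.assoc)
  also have "\<dots> = y * inv_elt x"
    by (simp add: mult.assoc inv_elt_cancel assms(1))
  finally show ?thesis .
qed

lemma inv_elt_adj:
  assumes "two_sided_invertible x"
  shows "two_sided_invertible (adj x)" "inv_elt (adj x) = adj (inv_elt x)"
proof -
  have 1: "adj x * adj (inv_elt x) = 1" "adj (inv_elt x) * adj x = 1"
    using inv_elt[OF assms] by (simp_all flip: adj_mult)
  then show *: "two_sided_invertible (adj x)"
    by (auto simp: two_sided_invertible_def)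
  show "inv_elt (adj x) = adj (inv_elt x)"
    using * 1 by (intro inv_elt_eqI)
qed

lemma two_sided_invertible_1 [simp]: "two_sided_invertible 1"
  by (auto simp: two_sided_invertible_def)

lemma two_sided_invertible_mult:
  assumes "two_sided_invertible x" "two_sided_invertible y"
  shows "two_sided_invertible (x * y)"
  unfolding two_sided_invertible_def
  by (rule exI[of _ "inv_elt y * inv_elt x"])
    (simp add: mult.assoc inv_elt inv_elt_cancel assms)

text \<open>With \<open>z\<close> the inverse of the commuting product, \<open>y * z\<close> is a
  right inverse of \<open>x\<close> and \<open>z * y\<close> a left inverse, so the two
  coincide.\<close>

lemma two_sided_invertible_factor:
  assumes "two_sided_invertible (x * y)" "x * y = y * x"
  shows "two_sided_invertible x"
proof -
  define z where "z = inv_elt (x * y)"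
  have 1: "x * (y * z) = 1" "z * (y * x) = 1"
    using inv_elt[OF assms(1)] unfolding z_def assms(2)[symmetric] by (simp_all add: mult.assoc)
  then have "z * y = y * z"
    by (metis mult.assoc mult.left_neutral mult.right_neutral)
  with 1 show ?thesis
    by (auto simp: two_sided_invertible_def simp flip: mult.assoc intro!: exI[of _ "y * z"])
qed

lemma two_sided_invertible_scaleC:
  assumes "two_sided_invertible x" "c \<noteq> 0"
  shows "two_sided_invertible (c *\<^sub>C x)"
  unfolding two_sided_invertible_def
  by (rule exI[of _ "inverse c *\<^sub>C inv_elt x"])
    (use assms in \<open>simp add: scaleC_mult_left scaleC_mult_right scaleC_scaleC inv_elt\<close>)

lemma two_sided_invertible_minus_iff [simp]:
  "two_sided_invertible (- x) \<longleftrightarrow> two_sided_invertible x"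
  using two_sided_invertible_scaleC[of x "-1"] two_sided_invertible_scaleC[of "- x" "-1"]
  by (auto simp: scaleC_minus_left)

lemma two_sided_invertible_scaleR:
  assumes "two_sided_invertible x" "r \<noteq> 0"
  shows "two_sided_invertible (r *\<^sub>R x)"
  using two_sided_invertible_scaleC[OF assms(1), of "of_real r"] assms(2)
  by (simp add: scaleC_complex_of_real)

lemma neumann_series:
  fixes z :: "'a::unital_cstar_algebra"
  assumes "norm z < 1"
  shows "two_sided_invertible (1 - z)" "norm (inv_elt (1 - z)) \<le> 1 / (1 - norm z)"
proof -
  have sn: "summable (\<lambda>n. norm (z ^ n))"
    by (rule summable_comparison_test'[where g = "\<lambda>n. norm z ^ n" and N = 0])
      (use assms in \<open>simp_all add: norm_power_ineq\<close>)
  then have s: "summable (\<lambda>n. z ^ n)"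
    by (rule summable_norm_cancel)
  define S where "S = (\<Sum>n. z ^ n)"
  have split: "S = 1 + (\<Sum>n. z ^ Suc n)"
    using suminf_split_head[OF s] by (simp add: S_def)
  have "z * S = (\<Sum>n. z ^ Suc n)" "S * z = (\<Sum>n. z ^ Suc n)"
    using suminf_mult[OF s, of z] suminf_mult2[OF s, of z] by (simp_all add: S_def power_commutes)
  then have inv: "(1 - z) * S = 1" "S * (1 - z) = 1"
    using split by (simp_all add: algebra_simps)
  then show i: "two_sided_invertible (1 - z)"
    by (auto simp: two_sided_invertible_def)
  have "inv_elt (1 - z) = S"
    by (rule inv_elt_eqI[OF i inv(2)])
  moreover have "norm S \<le> (\<Sum>n. norm z ^ n)"
    unfolding S_def by (rule norm_suminf_le) (use assms in \<open>simp_all add: norm_power_ineq\<close>)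
  ultimately show "norm (inv_elt (1 - z)) \<le> 1 / (1 - norm z)"
    using assms by (simp add: suminf_geometric)
qed

lemma two_sided_invertible_near_of_real:
  fixes x :: "'a::unital_cstar_algebra"
  assumes "norm (of_real s - x) < s"
  shows "two_sided_invertible x"
proof -
  have s: "s > 0"
    using assms norm_ge_zero le_less_trans by blast
  define z where "z = (1 / s) *\<^sub>R (of_real s - x)"
  have "norm z < 1"
    using assms s by (simp add: z_def)
  then have "two_sided_invertible (s *\<^sub>R (1 - z))"
    using s by (intro two_sided_invertible_scaleR neumann_series) auto
  moreover have "s *\<^sub>R (1 - z) = x"
    using s by (simp add: z_def of_real_def algebra_simps)
  ultimately show ?thesis by simp
qed

text \<open>Factor \<open>y = x * (1 - z)\<close> with \<open>z = inv_elt x * (x - y)\<close> of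
  norm at most 1/2 and use the Neumann series. The explicit bound, from the resolvent-type identity
  for the difference of the inverses, yields continuity of inversion.\<close>

lemma two_sided_invertible_near:
  fixes x y :: "'a::unital_cstar_algebra"
  assumes x: "two_sided_invertible x" and d: "norm (inv_elt x) * norm (y - x) \<le> 1 / 2"
  shows "two_sided_invertible y" "norm (inv_elt y - inv_elt x) \<le> 2 * (norm (inv_elt x))\<^sup>2 * norm (y - x)"
proof -
  define z where "z = inv_elt x * (x - y)"
  have z: "norm z \<le> 1 / 2"
    using norm_mult_ineq[of "inv_elt x" "x - y"] d by (simp add: z_def norm_minus_commute)
  have i: "two_sided_invertible (1 - z)"
    using z by (intro neumann_series) auto
  have y: "y = x * (1 - z)"
    by (simp add: z_def algebra_simps inv_elt inv_elt_cancel x)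
  show iy: "two_sided_invertible y"
    unfolding y by (intro two_sided_invertible_mult x i)
  have "inv_elt y = inv_elt (1 - z) * inv_elt x"
    by (rule inv_elt_eqI[OF iy]) (simp add: y mult.assoc inv_elt_cancel x inv_elt i)
  moreover have "norm (inv_elt (1 - z)) \<le> 2"
  proof -
    have "norm (inv_elt (1 - z)) \<le> 1 / (1 - norm z)"
      using z by (intro neumann_series) auto
    also have "\<dots> \<le> 2"
      using z by (simp add: field_simps)
    finally show ?thesis .
  qed
  ultimately have ny: "norm (inv_elt y) \<le> 2 * norm (inv_elt x)"
    by (metis mult_right_mono norm_ge_zero norm_mult_ineq order_trans)
  have "inv_elt y - inv_elt x = inv_elt y * ((x - y) * inv_elt x)"
    by (simp add: algebra_simps inv_elt_cancel iy inv_elt x)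
  also have "norm \<dots> \<le> norm (inv_elt y) * (norm (x - y) * norm (inv_elt x))"
    by (meson mult_left_mono norm_ge_zero norm_mult_ineq order_trans)
  also have "\<dots> \<le> 2 * norm (inv_elt x) * (norm (x - y) * norm (inv_elt x))"
    by (intro mult_right_mono ny) auto
  finally show "norm (inv_elt y - inv_elt x) \<le> 2 * (norm (inv_elt x))\<^sup>2 * norm (y - x)"
    by (simp add: power2_eq_square norm_minus_commute mult_ac)
qed

lemma tendsto_inv_elt:
  fixes f :: "'b \<Rightarrow> 'a::unital_cstar_algebra"
  assumes f: "(f \<longlongrightarrow> l) F" and l: "two_sided_invertible l"
  shows "eventually (\<lambda>x. two_sided_invertible (f x)) F" "((\<lambda>x. inv_elt (f x)) \<longlongrightarrow> inv_elt l) F"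
proof -
  have d: "((\<lambda>x. norm (f x - l)) \<longlongrightarrow> 0) F"
    using f by (simp add: tendsto_norm_zero_iff LIM_zero_iff)
  have "((\<lambda>x. norm (inv_elt l) * norm (f x - l)) \<longlongrightarrow> 0) F"
    using tendsto_mult_right_zero[OF d] by simp
  then have ev: "eventually (\<lambda>x. norm (inv_elt l) * norm (f x - l) < 1 / 2) F"
    by (rule order_tendstoD) simp
  then show "eventually (\<lambda>x. two_sided_invertible (f x)) F"
    by eventually_elim (use two_sided_invertible_near(1)[OF l] in force)
  have "((\<lambda>x. inv_elt (f x) - inv_elt l) \<longlongrightarrow> 0) F"
  proof (rule Lim_null_comparison)
    show "eventually (\<lambda>x. norm (inv_elt (f x) - inv_elt l)
        \<le> 2 * (norm (inv_elt l))\<^sup>2 * norm (f x - l)) F"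
      using ev by eventually_elim (use two_sided_invertible_near(2)[OF l] in force)
    show "((\<lambda>x. 2 * (norm (inv_elt l))\<^sup>2 * norm (f x - l)) \<longlongrightarrow> 0) F"
      using tendsto_mult_right_zero[OF d] by simp
  qed
  then show "((\<lambda>x. inv_elt (f x)) \<longlongrightarrow> inv_elt l) F"
    by (simp add: LIM_zero_iff)
qed

section \<open>The square root of \<open>1 - z\<close>\<close>

text \<open>The Taylor coefficients of \<open>sqrt (1 - z)\<close> at 0.\<close>

definition sqrt_coeff :: "nat \<Rightarrow> real" where
  "sqrt_coeff n = ((1 / 2) gchoose n) * (-1) ^ n"

lemma sqrt_coeff_0 [simp]: "sqrt_coeff 0 = 1"
  by (simp add: sqrt_coeff_def)

lemma sqrt_coeff_rec: "sqrt_coeff (Suc n) = sqrt_coeff n * ((real n - 1 / 2) / (real n + 1))"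
proof -
  have "(1/2 - real n) * ((1/2) gchoose n) = (real n + 1) * ((1/2::real) gchoose (Suc n))"
    using gbinomial_mult_1[of "1/2::real" n] by (simp add: algebra_simps)
  then have "((1/2) gchoose (Suc n)) = ((1/2) gchoose n) * ((1/2 - real n) / (real n + 1))"
    by (simp add: field_simps)
  then show ?thesis
    by (simp add: sqrt_coeff_def) (simp add: algebra_simps add_divide_distrib diff_divide_distrib)
qed

lemma sqrt_coeff_Suc_nonpos: "sqrt_coeff (Suc n) \<le> 0"
proof (induction n)
  case 0
  show ?case by (simp add: sqrt_coeff_rec)
next
  case (Suc n)
  then show ?case
    unfolding sqrt_coeff_rec[of "Suc n"] by (intro mult_nonpos_nonneg) auto
qed

text \<open>All coefficients after the first are nonpositive, so for \<open>0 < t < 1\<close> the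
  series of absolute values weighted by powers of \<open>t\<close> sums to
  \<open>1 - sqrt (1 - t)\<close>, which is at most 1. Let \<open>t\<close> tend to 1. This makes
  the power series converge absolutely on the closed unit ball.\<close>

lemma sum_sqrt_coeff_le: "(\<Sum>n<N. \<bar>sqrt_coeff (Suc n)\<bar>) \<le> 1"
proof -
  have le: "(\<Sum>n<N. \<bar>sqrt_coeff (Suc n)\<bar> * t ^ Suc n) \<le> 1" if t: "0 < t" "t < 1" for t
  proof -
    have "(\<lambda>n. ((1/2) gchoose n) * (-t) ^ n) sums (1 + (-t)) powr (1/2)"
      using t by (intro gen_binomial_real) auto
    then have s: "(\<lambda>n. sqrt_coeff n * t ^ n) sums (1 - t) powr (1/2)"
      by (simp add: sqrt_coeff_def power_minus[of t] mult_ac)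
    then have "(\<lambda>n. sqrt_coeff (Suc n) * t ^ Suc n) sums ((1 - t) powr (1/2) - 1)"
      using sums_Suc_iff[of "\<lambda>n. sqrt_coeff n * t ^ n"] by simp
    then have "(\<lambda>n. - (sqrt_coeff (Suc n) * t ^ Suc n)) sums - ((1 - t) powr (1/2) - 1)"
      by (rule sums_minus)
    moreover have "- (sqrt_coeff (Suc n) * t ^ Suc n) = \<bar>sqrt_coeff (Suc n)\<bar> * t ^ Suc n" for n
      using sqrt_coeff_Suc_nonpos[of n] by simp
    ultimately have s2: "(\<lambda>n. \<bar>sqrt_coeff (Suc n)\<bar> * t ^ Suc n) sums (1 - (1 - t) powr (1/2))"
      by simp
    have "(\<Sum>n<N. \<bar>sqrt_coeff (Suc n)\<bar> * t ^ Suc n) \<le> (1 - (1 - t) powr (1/2))"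
      using s2 t by (intro sums_le[OF _ sums_If_finite_set[of "{..<N}"] s2, THEN order_trans[rotated]]) auto
    also have "\<dots> \<le> 1" by simp
    finally show ?thesis .
  qed
  have "((\<lambda>t. \<Sum>n<N. \<bar>sqrt_coeff (Suc n)\<bar> * t ^ Suc n)
      \<longlongrightarrow> (\<Sum>n<N. \<bar>sqrt_coeff (Suc n)\<bar> * 1 ^ Suc n)) (at_left 1)"
    by (intro tendsto_intros)
  moreover have "eventually (\<lambda>t::real. t \<in> {0<..<1}) (at_left 1)"
    by (rule eventually_at_leftI[of 0]) auto
  then have "eventually (\<lambda>t. (\<Sum>n<N. \<bar>sqrt_coeff (Suc n)\<bar> * t ^ Suc n) \<le> 1) (at_left 1)"
    by eventually_elim (rule le, auto)
  ultimately show ?thesis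
    using tendsto_upperbound[of _ _ "at_left (1::real)" 1] by simp
qed

lemma summable_sqrt_coeff: "summable (\<lambda>n. \<bar>sqrt_coeff n\<bar>)"
  and suminf_sqrt_coeff_le: "(\<Sum>n. \<bar>sqrt_coeff (Suc n)\<bar>) \<le> 1"
proof -
  have s: "summable (\<lambda>n. \<bar>sqrt_coeff (Suc n)\<bar>)"
    by (rule bounded_imp_summable[where B = 1])
      (use sum_sqrt_coeff_le[of "Suc _"] in \<open>auto simp: lessThan_Suc_atMost\<close>)
  then show "summable (\<lambda>n. \<bar>sqrt_coeff n\<bar>)"
    using summable_Suc_iff[of "\<lambda>n. \<bar>sqrt_coeff n\<bar>"] by simp
  show "(\<Sum>n. \<bar>sqrt_coeff (Suc n)\<bar>) \<le> 1"
    by (rule suminf_le_const[OF s sum_sqrt_coeff_le])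
qed

text \<open>Vandermonde convolution: the Cauchy square of the series is the expansion of
  \<open>1 - z\<close>.\<close>

lemma sqrt_coeff_conv:
  "(\<Sum>i\<le>n. sqrt_coeff i * sqrt_coeff (n - i)) = (if n = 0 then 1 else if n = 1 then -1 else 0)"
proof -
  have "(\<Sum>i\<le>n. sqrt_coeff i * sqrt_coeff (n - i))
      = (\<Sum>i\<le>n. ((1/2) gchoose i) * ((1/2) gchoose (n - i))) * (-1) ^ n"
    unfolding sum_distrib_right
  proof (rule sum.cong)
    fix i assume "i \<in> {..n}"
    then have "(-1::real) ^ n = (-1) ^ i * (-1) ^ (n - i)"
      by (simp flip: power_add)
    then show "sqrt_coeff i * sqrt_coeff (n - i)
        = ((1/2) gchoose i) * ((1/2) gchoose (n - i)) * (-1) ^ n"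
      by (simp add: sqrt_coeff_def)
  qed simp
  also have "(\<Sum>i\<le>n. ((1/2) gchoose i) * ((1/2) gchoose (n - i))) = ((1::real) gchoose n)"
    using gbinomial_Vandermonde[of "1/2::real" "1/2" n] by (simp add: atMost_atLeast0)
  also have "((1::real) gchoose n) = real (1 choose n)"
    using binomial_gbinomial[of 1 n, where ?'a = real] by simp
  finally show ?thesis
    by (auto simp: binomial_eq_0)
qed

definition sqrt_one_minus :: "'a::unital_cstar_algebra \<Rightarrow> 'a" where
  "sqrt_one_minus z = (\<Sum>n. sqrt_coeff n *\<^sub>R z ^ n)"

context
  fixes z :: "'a::unital_cstar_algebra"
  assumes z: "norm z \<le> 1"
begin

lemma norm_sqrt_term: "norm (sqrt_coeff n *\<^sub>R z ^ n) \<le> \<bar>sqrt_coeff n\<bar>"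
proof -
  have "norm (z ^ n) \<le> 1"
    using norm_power_ineq[of z n] power_le_one[OF norm_ge_zero z, of n] by linarith
  then show ?thesis
    by (simp add: mult_left_le)
qed

lemma summable_norm_sqrt: "summable (\<lambda>n. norm (sqrt_coeff n *\<^sub>R z ^ n))"
  by (rule summable_comparison_test'[OF summable_sqrt_coeff, where N = 0])
    (use norm_sqrt_term in auto)

lemma summable_sqrt: "summable (\<lambda>n. sqrt_coeff n *\<^sub>R z ^ n)"
  by (rule summable_norm_cancel[OF summable_norm_sqrt])

lemma sqrt_one_minus_square: "sqrt_one_minus z * sqrt_one_minus z = 1 - z"
proof -
  have "sqrt_one_minus z * sqrt_one_minus z
      = (\<Sum>n. \<Sum>i\<le>n. (sqrt_coeff i *\<^sub>R z ^ i) * (sqrt_coeff (n - i) *\<^sub>R z ^ (n - i)))"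
    unfolding sqrt_one_minus_def by (rule Cauchy_product[OF summable_norm_sqrt summable_norm_sqrt])
  also have "(\<lambda>n. \<Sum>i\<le>n. (sqrt_coeff i *\<^sub>R z ^ i) * (sqrt_coeff (n - i) *\<^sub>R z ^ (n - i)))
      = (\<lambda>n. (if n = 0 then 1 else if n = 1 then -1 else 0) *\<^sub>R z ^ n)"
    by (simp flip: sqrt_coeff_conv power_add add: scaleR_sum_left mult.commute)
  also have "suminf \<dots> = (\<Sum>n\<in>{0, 1}. (if n = 0 then 1 else if n = 1 then -1 else 0) *\<^sub>R z ^ n)"
    by (rule suminf_finite) auto
  finally show ?thesis by simp
qed

lemma adj_sqrt_one_minus:
  assumes "adj z = z"
  shows "adj (sqrt_one_minus z) = sqrt_one_minus z"
  unfolding sqrt_one_minus_def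
  using bounded_linear.suminf[OF bounded_linear_adj summable_sqrt] assms by simp

lemma sqrt_one_minus_commute:
  assumes "x * z = z * x"
  shows "x * sqrt_one_minus z = sqrt_one_minus z * x"
proof -
  have "x * z ^ n = z ^ n * x" for n
    using power_commuting_commutes[OF assms[symmetric], of n] by simp
  then show ?thesis
    unfolding sqrt_one_minus_def using suminf_mult[OF summable_sqrt, of x]
      suminf_mult2[OF summable_sqrt, of x] by simp
qed

text \<open>The constant term 1 cancels, and the remaining coefficients have absolute sum at most 1.
  Through this bound the square root is itself seen to be positive.\<close>

lemma norm_one_minus_sqrt_one_minus: "norm (1 - sqrt_one_minus z) \<le> 1"
proof -
  have "sqrt_one_minus z = 1 + (\<Sum>n. sqrt_coeff (Suc n) *\<^sub>R z ^ Suc n)"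
    unfolding sqrt_one_minus_def using suminf_split_head[OF summable_sqrt] by simp
  then have "norm (1 - sqrt_one_minus z) = norm (\<Sum>n. sqrt_coeff (Suc n) *\<^sub>R z ^ Suc n)"
    by simp
  also have "\<dots> \<le> (\<Sum>n. \<bar>sqrt_coeff (Suc n)\<bar>)"
    by (rule norm_suminf_le[OF norm_sqrt_term])
      (use summable_Suc_iff[of "\<lambda>n. \<bar>sqrt_coeff n\<bar>"] summable_sqrt_coeff in simp)
  also have "\<dots> \<le> 1" by (rule suminf_sqrt_coeff_le)
  finally show ?thesis .
qed

end

lemma continuous_on_sqrt_one_minus:
  "continuous_on (cball 0 1) (sqrt_one_minus :: 'a::unital_cstar_algebra \<Rightarrow> 'a)"
proof (rule uniform_limit_theorem[where F = sequentially])
  show "uniform_limit (cball 0 1) (\<lambda>N z. \<Sum>n<N. sqrt_coeff n *\<^sub>R z ^ n)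
      (sqrt_one_minus :: 'a \<Rightarrow> 'a) sequentially"
    unfolding sqrt_one_minus_def
    by (rule Weierstrass_m_test[OF norm_sqrt_term summable_sqrt_coeff]) simp
qed (auto intro!: always_eventually continuous_intros)


section \<open>Positive elements\<close>

text \<open>
  Agrees with the spectral notion of positivity by \<open>positive_element_iff_pos\<close>.
\<close>

definition pos :: "'a::unital_cstar_algebra \<Rightarrow> bool" where
  "pos h \<longleftrightarrow> (\<exists>x. adj x = x \<and> h = x * x)"

lemma pos_adj: "pos h \<Longrightarrow> adj h = h"
  by (auto simp: pos_def)

lemma norm_unitary:
  fixes u :: "'a::unital_cstar_algebra"
  assumes "adj u * u = of_real (r\<^sup>2)" "r \<ge> 0"
  shows "norm u = r"
proof (rule power2_eq_imp_eq)
  show "(norm u)\<^sup>2 = r\<^sup>2"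
    unfolding cstar_identity[symmetric] assms(1) norm_of_real by simp
qed (use assms in auto)

text \<open>The element \<open>u = x + \<i> *\<^sub>C y\<close> satisfies
  \<open>adj u * u = of_real (r^2)\<close>, so it has norm \<open>r\<close>, and \<open>x\<close> is
  its real part.\<close>

lemma norm_le_of_sum_squares:
  fixes x y :: "'a::unital_cstar_algebra"
  assumes "adj x = x" "adj y = y" "x * y = y * x" "x * x + y * y = of_real (r\<^sup>2)" "r \<ge> 0"
  shows "norm x \<le> r"
proof -
  define u where "u = x + \<i> *\<^sub>C y"
  have adj_u: "adj u = x - \<i> *\<^sub>C y"
    by (simp add: u_def assms scaleC_minus_left)
  have "adj u * u = (x - \<i> *\<^sub>C y) * (x + \<i> *\<^sub>C y)"
    by (simp only: adj_u) (simp only: u_def)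
  also have "\<dots> = x * x + y * y"
    by (simp add: algebra_simps assms(3) scaleC_mult_left scaleC_mult_right scaleC_scaleC
        scaleC_add_right scaleC_diff_right scaleC_minus_left)
  finally have u: "norm u = r"
    using assms by (intro norm_unitary) auto
  have "2 *\<^sub>R x = u + adj u"
    unfolding adj_u by (simp add: u_def scaleR_2)
  then have "2 * norm x = norm (u + adj u)"
    by (metis abs_numeral norm_scaleR)
  also have "\<dots> \<le> norm u + norm (adj u)"
    by (rule norm_triangle_ineq)
  finally show ?thesis
    by (simp add: u)
qed

text \<open>For \<open>s > 0\<close> and \<open>h = x * x\<close>, the power series provides a
  self-adjoint root \<open>y\<close> of \<open>s - h\<close> that commutes with \<open>x\<close>. As
  the squares of \<open>x\<close> and \<open>y\<close> add up to \<open>s\<close>,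
  \<open>norm y <= sqrt s\<close>. This is the converse of the criterion \<open>posI\<close>
  below.\<close>

lemma norm_of_real_minus_pos:
  fixes h :: "'a::unital_cstar_algebra"
  assumes "pos h" "norm h \<le> s"
  shows "norm (of_real s - h) \<le> s"
proof (cases "s = 0")
  case False
  then have s: "s > 0"
    using assms(2) norm_ge_zero[of h] by linarith
  obtain x where x: "adj x = x" "h = x * x"
    using assms(1) by (auto simp: pos_def)
  define z where "z = (1 / s) *\<^sub>R h"
  define y where "y = sqrt s *\<^sub>R sqrt_one_minus z"
  have z: "norm z \<le> 1"
    using assms(2) s by (simp add: z_def)
  have y: "adj y = y"
    unfolding y_def using z by (simp add: adj_sqrt_one_minus z_def x)
  have yy: "y * y = of_real s - h"
    using s by (simp add: y_def sqrt_one_minus_square[OF z]) (simp add: z_def of_real_def algebra_simps)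
  have "x * sqrt_one_minus z = sqrt_one_minus z * x"
    by (rule sqrt_one_minus_commute[OF z]) (simp add: z_def x mult.assoc)
  then have xy: "y * x = x * y"
    by (simp add: y_def)
  have "norm y \<le> sqrt s"
    by (rule norm_le_of_sum_squares[OF y x(1) xy]) (use s x yy in simp_all)
  then have "(norm y)\<^sup>2 \<le> (sqrt s)\<^sup>2"
    by (intro power_mono) auto
  then show ?thesis
    using norm_self_adjoint_square[OF y] yy s by simp
qed (use assms in auto)

section \<open>Square roots by expansion about a positive scalar\<close>

text \<open>Write \<open>h = s (1 - z)\<close> with \<open>z = 1 - h / s\<close>. The condition
  \<open>norm (s - h) <= s\<close> says exactly that \<open>z\<close> lies in the closed unit ball,
  where the series converges.\<close>

definition root_at :: "real \<Rightarrow> 'a::unital_cstar_algebra \<Rightarrow> 'a" where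
  "root_at s h = sqrt s *\<^sub>R sqrt_one_minus (1 - (1 / s) *\<^sub>R h)"

context
  fixes h :: "'a::unital_cstar_algebra" and s :: real
  assumes h: "adj h = h" "norm (of_real s - h) \<le> s" and s: "s > 0"
begin

lemma norm_root_arg: "norm (1 - (1 / s) *\<^sub>R h) \<le> 1"
proof -
  have "1 - (1 / s) *\<^sub>R h = (1 / s) *\<^sub>R (of_real s - h)"
    using s by (simp add: of_real_def algebra_simps)
  also have "norm \<dots> \<le> 1"
    using h s by simp
  finally show ?thesis .
qed

lemma adj_root_at: "adj (root_at s h) = root_at s h"
  unfolding root_at_def by (simp add: adj_sqrt_one_minus norm_root_arg h)

lemma root_at_square: "root_at s h * root_at s h = h"
  using s by (simp add: root_at_def sqrt_one_minus_square norm_root_arg)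

lemma root_at_commute:
  assumes "x * h = h * x"
  shows "x * root_at s h = root_at s h * x"
proof -
  have "x * (1 - (1 / s) *\<^sub>R h) = (1 - (1 / s) *\<^sub>R h) * x"
    using assms by (simp add: algebra_simps)
  then show ?thesis
    using sqrt_one_minus_commute[OF norm_root_arg] by (simp add: root_at_def)
qed

lemma norm_of_real_minus_root_at: "norm (of_real (sqrt s) - root_at s h) \<le> sqrt s"
proof -
  have "of_real (sqrt s) - root_at s h = sqrt s *\<^sub>R (1 - sqrt_one_minus (1 - (1 / s) *\<^sub>R h))"
    by (simp add: root_at_def of_real_def algebra_simps)
  also have "norm \<dots> \<le> sqrt s"
    using s norm_one_minus_sqrt_one_minus[OF norm_root_arg] by (simp add: mult_left_le)
  finally show ?thesis .
qed

lemma posI: "pos h"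
  unfolding pos_def using adj_root_at root_at_square by metis

end

lemma pos_root_at:
  fixes h :: "'a::unital_cstar_algebra"
  assumes "adj h = h" "norm (of_real s - h) \<le> s" "s > 0"
  shows "pos (root_at s h)"
  by (rule posI[OF adj_root_at[OF assms] norm_of_real_minus_root_at[OF assms]]) (use assms in simp)

lemma pos_root:
  fixes h :: "'a::unital_cstar_algebra"
  assumes "pos h"
  obtains k where "pos k" "k * k = h" "\<And>x. x * h = h * x \<Longrightarrow> x * k = k * x"
proof -
  define s where "s = norm h + 1"
  have s: "norm (of_real s - h) \<le> s" "s > 0"
    by (rule norm_of_real_minus_pos[OF assms]) (simp_all add: s_def add_nonneg_pos)
  note * = pos_adj[OF assms] s
  show ?thesis
    using that[OF pos_root_at[OF *] root_at_square[OF *] root_at_commute[OF *]] by blast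
qed

lemma pos_square: "adj x = x \<Longrightarrow> pos (x * x)"
  by (auto simp: pos_def)

lemma pos_of_real: "r \<ge> 0 \<Longrightarrow> pos (of_real r)"
  unfolding pos_def by (rule exI[of _ "of_real (sqrt r)"]) (simp flip: of_real_mult)

text \<open>The criterion \<open>norm (s - h) <= s\<close> is additive: radii for \<open>h\<close>
  and \<open>k\<close> add up to a radius for \<open>h + k\<close> by the triangle
  inequality.\<close>

lemma pos_add:
  fixes h k :: "'a::unital_cstar_algebra"
  assumes "pos h" "pos k"
  shows "pos (h + k)"
proof (rule posI)
  define s t where "s = norm h + 1" and "t = norm k + 1"
  have "of_real (s + t) - (h + k) = (of_real s - h) + (of_real t - k)"
    by simp
  also have "norm \<dots> \<le> s + t"
    by (intro norm_triangle_mono norm_of_real_minus_pos assms) (auto simp: s_def t_def)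
  finally show "norm (of_real (s + t) - (h + k)) \<le> s + t" .
  show "s + t > 0"
    unfolding s_def t_def by (intro add_pos_pos add_nonneg_pos) auto
qed (use assms in \<open>simp add: pos_adj\<close>)

lemma pos_scaleR:
  fixes h :: "'a::unital_cstar_algebra"
  assumes "pos h" "r \<ge> 0"
  shows "pos (r *\<^sub>R h)"
proof -
  obtain x where "adj x = x" "h = x * x"
    using assms(1) by (auto simp: pos_def)
  then show ?thesis
    using assms(2) unfolding pos_def by (intro exI[of _ "sqrt r *\<^sub>R x"]) simp
qed

lemma two_sided_invertible_pos_add:
  fixes h :: "'a::unital_cstar_algebra"
  assumes "pos h" "t > 0"
  shows "two_sided_invertible (h + of_real t)"
proof (rule two_sided_invertible_near_of_real)
  have "norm (of_real (norm h) - h) \<le> norm h"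
    using assms by (intro norm_of_real_minus_pos) auto
  then show "norm (of_real (norm h + t) - (h + of_real t)) < norm h + t"
    using assms by simp
qed

text \<open>Let \<open>h = x * x\<close>, let \<open>y\<close> be the inverse of \<open>x\<close>
  and \<open>M = (norm y)^2\<close>. Then \<open>M - y * y\<close> has a self-adjoint root
  \<open>z\<close> commuting with \<open>x\<close>, and \<open>(x * z)^2 = M h - 1\<close>. Hence
  \<open>e = 1 / M\<close> works.\<close>

lemma pos_lower_bound:
  fixes h :: "'a::unital_cstar_algebra"
  assumes h: "pos h" and i: "two_sided_invertible h"
  obtains e where "e > 0" "pos (h - of_real e)"
proof -
  obtain x where x: "adj x = x" "h = x * x"
    using h by (auto simp: pos_def)
  have ix: "two_sided_invertible x"
    using two_sided_invertible_factor[of x x] i x by simp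
  define y where "y = inv_elt x"
  have y: "adj y = y" "x * y = 1" "y * x = 1"
    using inv_elt_adj[OF ix] inv_elt[OF ix] x by (simp_all add: y_def)
  define M where "M = (norm y)\<^sup>2"
  have "y \<noteq> 0"
    using y by auto
  then have M: "M > 0"
    by (simp add: M_def)
  have "norm (of_real M - (of_real M - y * y)) \<le> M"
    using norm_self_adjoint_square[OF y(1)] by (simp add: M_def)
  note * = this M
  have a: "adj (of_real M - y * y) = of_real M - y * y"
    by (simp add: y)
  define z where "z = root_at M (of_real M - y * y)"
  have z: "adj z = z" "z * z = of_real M - y * y"
    unfolding z_def by (rule adj_root_at[OF a *] root_at_square[OF a *])+
  have xy2: "x * (y * y) = y * y * x"
    by (simp add: y(2,3) mult.assoc[symmetric, of x]) (simp add: y(3) mult.assoc)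
  have xz: "x * z = z * x"
    unfolding z_def by (rule root_at_commute[OF a *])
      (simp add: algebra_simps xy2 of_real_commute[of M x])
  have "(x * z) * (x * z) = (x * z) * (z * x)"
    by (simp only: xz)
  also have "\<dots> = x * (z * z) * x"
    by (simp only: mult.assoc)
  also have "\<dots> = M *\<^sub>R h - x * (y * y) * x"
    unfolding z x by (simp add: algebra_simps of_real_def)
  also have "x * (y * y) * x = 1"
    by (simp add: y(2,3) mult.assoc[symmetric])
  finally have xz2: "(x * z) * (x * z) = M *\<^sub>R h - 1" .
  have "pos (M *\<^sub>R h - 1)"
    unfolding xz2[symmetric] by (rule pos_square) (simp add: x z xz)
  then have "pos ((1 / M) *\<^sub>R (M *\<^sub>R h - 1))"
    using M by (intro pos_scaleR) auto
  moreover have "(1 / M) *\<^sub>R (M *\<^sub>R h - 1) = h - of_real (1 / M)"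
    using M by (simp add: algebra_simps of_real_def)
  ultimately show ?thesis
    using M by (intro that[of "1 / M"]) auto
qed

text \<open>For \<open>t <= 1\<close> the radius \<open>norm h + 2\<close> bounds the norm of
  \<open>h + t\<close>, so one radius serves for all small \<open>t\<close> and the norm inequality
  passes to the limit.\<close>

lemma pos_closed:
  fixes h :: "'a::unital_cstar_algebra"
  assumes "\<And>t. t > 0 \<Longrightarrow> pos (h + of_real t)"
  shows "pos h"
proof (rule posI)
  show s: "norm h + 2 > 0"
    by (simp add: add_nonneg_pos)
  have "adj (h + of_real 1) = h + of_real 1"
    using pos_adj[OF assms[of 1]] by simp
  then show "adj h = h" by simp
  show "norm (of_real (norm h + 2) - h) \<le> norm h + 2"
  proof (rule field_le_epsilon)
    fix e :: real assume "e > 0"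
    define t where "t = min e 1"
    have t: "t > 0" "t \<le> e" "t \<le> 1"
      using \<open>e > 0\<close> by (auto simp: t_def)
    have "norm (h + of_real t) \<le> norm h + 2"
      by (rule order_trans[OF norm_triangle_ineq]) (use t in simp)
    then have le: "norm (of_real (norm h + 2) - (h + of_real t)) \<le> norm h + 2"
      using t by (intro norm_of_real_minus_pos assms)
    have "of_real (norm h + 2) - h = (of_real (norm h + 2) - (h + of_real t)) + of_real t"
      by simp
    also have "norm \<dots> \<le> (norm h + 2) + t"
      using t by (intro norm_triangle_mono le) auto
    finally show "norm (of_real (norm h + 2) - h) \<le> norm h + 2 + e"
      using t by linarith
  qed
qed

lemma pos_mono:
  assumes "pos (h + of_real s :: 'a::unital_cstar_algebra)" "s \<le> t"
  shows "pos (h + of_real t)"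
  using pos_add[OF assms(1) pos_of_real[of "t - s"]] assms(2) by simp

text \<open>
  If \<open>h + t \<ge> 0\<close> with \<open>t > 0\<close>, invertibility of \<open>h + t\<close> allows \<open>t\<close> to be decreased; so the
  infimum of these \<open>t\<close> is \<open>0\<close>.
\<close>

lemma pos_of_spectrum:
  fixes h :: "'a::unital_cstar_algebra"
  assumes h: "adj h = h" and i: "\<And>t. t > 0 \<Longrightarrow> two_sided_invertible (h + of_real t)"
  shows "pos h"
proof -
  define T where "T = {t. t \<ge> 0 \<and> pos (h + of_real t)}"
  have "pos (h + of_real (norm h + 1))"
    by (rule posI[of _ "norm h + 1"]) (simp_all add: h add_nonneg_pos)
  then have ne: "T \<noteq> {}"
    by (auto simp: T_def intro!: exI[of _ "norm h + 1"])
  have bdd: "bdd_below T"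
    by (auto simp: T_def intro: bdd_belowI[of _ 0])
  define t where "t = Inf T"
  have above: "pos (h + of_real s)" if "s > t" for s
    using that cInf_less_iff[OF ne bdd, of s] pos_mono[of h _ s]
    by (auto simp: t_def T_def)
  have "t \<ge> 0"
    unfolding t_def by (rule cInf_greatest[OF ne]) (auto simp: T_def)
  have pt: "pos (h + of_real t)"
    by (rule pos_closed) (use above[of "t + _"] in \<open>simp add: add.assoc\<close>)
  have "\<not> t > 0"
  proof
    assume "t > 0"
    then obtain e where e: "e > 0" "pos (h + of_real t - of_real e)"
      using pos_lower_bound[OF pt i] by blast
    \<comment> \<open>Truncation at 0 keeps \<open>t'\<close> in \<open>T\<close>, which admits only
      nonnegative numbers.\<close>
    define t' where "t' = max 0 (t - e)"
    have "pos (h + of_real (t - e))"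
      using e by (simp add: algebra_simps)
    then have "pos (h + of_real t')"
      by (rule pos_mono) (simp add: t'_def)
    then have "t' \<in> T"
      by (simp add: T_def t'_def)
    then have "t \<le> t'"
      unfolding t_def by (rule cInf_lower[OF _ bdd])
    then show False
      using e \<open>t > 0\<close> by (simp add: t'_def)
  qed
  with pt \<open>t \<ge> 0\<close> show ?thesis
    by (simp add: not_less)
qed

text \<open>Positive roots \<open>x\<close> of \<open>h\<close> and \<open>y\<close> of
  \<open>r - h\<close> commute and their squares add up to \<open>r\<close>, so
  \<open>norm x <= sqrt r\<close>.\<close>

lemma norm_le_of_pos:
  fixes h :: "'a::unital_cstar_algebra"
  assumes "pos h" "pos (of_real r - h)" "r \<ge> 0"
  shows "norm h \<le> r"
proof -
  obtain x where x: "pos x" "x * x = h" "\<And>z. z * h = h * z \<Longrightarrow> z * x = x * z"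
    using pos_root[OF assms(1)] by blast
  obtain y where y: "pos y" "y * y = of_real r - h"
    "\<And>z. z * (of_real r - h) = (of_real r - h) * z \<Longrightarrow> z * y = y * z"
    using pos_root[OF assms(2)] by blast
  have "x * y = y * x"
    by (rule y(3)) (simp add: algebra_simps of_real_commute x(2)[symmetric])
  then have "norm x \<le> sqrt r"
    by (intro norm_le_of_sum_squares[of x y] pos_adj x(1) y(1))
      (use assms(3) in \<open>simp_all add: x(2) y(2)\<close>)
  then have "(norm x)\<^sup>2 \<le> (sqrt r)\<^sup>2"
    by (intro power_mono) auto
  then show ?thesis
    using norm_self_adjoint_square[OF pos_adj[OF x(1)]] assms(3) by (simp add: x(2))
qed

lemma pos_antisym:
  assumes "pos h" "pos (- h)"
  shows "h = (0::'a::unital_cstar_algebra)"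
  using norm_le_of_pos[of h 0] assms by simp

text \<open>The positive element \<open>norm h - h\<close> cannot be invertible: a positive lower
  bound for it would improve the estimate \<open>h <= norm h\<close>, and hence the norm
  itself.\<close>

lemma norm_in_spectrum:
  fixes h :: "'a::unital_cstar_algebra"
  assumes h: "pos h" "h \<noteq> 0"
  shows "\<not> two_sided_invertible (of_real (norm h) - h)"
proof
  assume i: "two_sided_invertible (of_real (norm h) - h)"
  have "pos (of_real (norm h) - h)"
    by (rule posI[of _ "norm h"]) (use h in \<open>simp_all add: pos_adj\<close>)
  then obtain e where e: "e > 0" "pos (of_real (norm h) - h - of_real e)"
    using pos_lower_bound i by blast
  \<comment> \<open>The cap at \<open>norm h\<close> keeps the new bound \<open>norm h - d\<close>
    nonnegative.\<close>
  define d where "d = min e (norm h)"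
  have "pos ((of_real (norm h) - h) + of_real (- d))"
    by (rule pos_mono[of _ "- e"]) (use e in \<open>simp_all add: d_def\<close>)
  then have "pos (of_real (norm h - d) - h)"
    by (simp add: algebra_simps)
  then have "norm h \<le> norm h - d"
    by (rule norm_le_of_pos[OF h(1)]) (simp add: d_def)
  then show False
    using e h(2) by (simp add: d_def min_def split: if_splits)
qed


section \<open>Positivity of \<open>adj a * a\<close>\<close>

text \<open>If \<open>z\<close> inverts \<open>x * y + t\<close>, then
  \<open>(1 - y * z * x) / t\<close> inverts \<open>y * x + t\<close>. Thus \<open>x * y\<close> and
  \<open>y * x\<close> have the same nonzero real spectrum.\<close>

lemma two_sided_invertible_mult_commute_add:
  fixes x y :: "'a::unital_cstar_algebra"
  assumes "two_sided_invertible (x * y + of_real t)" "t \<noteq> 0"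
  shows "two_sided_invertible (y * x + of_real t)"
proof -
  define z where "z = inv_elt (x * y + of_real t)"
  define w where "w = (1 / t) *\<^sub>R (1 - y * z * x)"
  have z: "x * (y * z) = 1 - t *\<^sub>R z" "z * (x * y) = 1 - t *\<^sub>R z"
    using inv_elt[OF assms(1), folded z_def]
    by (simp_all add: distrib_left distrib_right of_real_def mult.assoc eq_diff_eq)
  have "x * (y * (z * x)) = (x * (y * z)) * x" "z * (x * (y * x)) = (z * (x * y)) * x"
    by (simp_all only: mult.assoc)
  then have 1: "x * (y * (z * x)) = x - t *\<^sub>R (z * x)" "z * (x * (y * x)) = x - t *\<^sub>R (z * x)"
    by (simp_all only: z) (simp_all add: algebra_simps)
  have "(y * x + of_real t) * (1 - y * z * x) = t *\<^sub>R 1"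
    "(1 - y * z * x) * (y * x + of_real t) = t *\<^sub>R 1"
    by (simp_all add: algebra_simps of_real_def 1)
  then have "(y * x + of_real t) * w = 1" "w * (y * x + of_real t) = 1"
    using assms(2) by (simp_all add: w_def)
  then show ?thesis
    by (auto simp: two_sided_invertible_def)
qed

text \<open>Here \<open>k\<close> plays the role of the absolute value of \<open>h\<close>. For
  \<open>t > 0\<close> the commuting product of \<open>k - h + t\<close> and
  \<open>k + h + t\<close> equals \<open>2 t (k + t / 2)\<close>, which is invertible; so
  \<open>k - h + t\<close> is invertible.\<close>

lemma pos_root_minus:
  fixes h k :: "'a::unital_cstar_algebra"
  assumes h: "adj h = h" and k: "pos k" "k * k = h * h" "h * k = k * h"
  shows "pos (k - h)"
proof (rule pos_of_spectrum)
  show "adj (k - h) = k - h"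
    by (simp add: h pos_adj[OF k(1)])
  fix t :: real assume t: "t > 0"
  have prod: "(k - h + of_real t) * (k + h + of_real t) = 2 *\<^sub>R (t *\<^sub>R (k + of_real (t / 2)))"
    by (simp add: algebra_simps of_real_def k scaleR_2) (simp only: mult_2_right scaleR_add_left)
  have comm: "(k - h + of_real t) * (k + h + of_real t) = (k + h + of_real t) * (k - h + of_real t)"
    by (simp add: algebra_simps of_real_def k)
  have "two_sided_invertible (2 *\<^sub>R (t *\<^sub>R (k + of_real (t / 2))))"
    using t k by (intro two_sided_invertible_scaleR two_sided_invertible_pos_add) auto
  then show "two_sided_invertible (k - h + of_real t)"
    unfolding prod[symmetric] by (rule two_sided_invertible_factor[OF _ comm])
qed

text \<open>Take \<open>x\<close> to be the real part of \<open>b\<close> and \<open>y\<close> the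
  negative of its imaginary part; the cross terms cancel in the sum.\<close>

lemma adj_mult_self_sum:
  fixes b :: "'a::unital_cstar_algebra"
  obtains x y where "adj x = x" "adj y = y" "adj b * b + b * adj b = 2 *\<^sub>R (x * x + y * y)"
proof -
  define x where "x = (1 / 2) *\<^sub>R (b + adj b)"
  define w where "w = (1 / 2) *\<^sub>R (b - adj b)"
  define y where "y = \<i> *\<^sub>C w"
  have "y * y = (\<i> * \<i>) *\<^sub>C (w * w)"
    by (simp add: y_def scaleC_mult_left scaleC_mult_right scaleC_scaleC)
  then have yy: "y * y = - (w * w)"
    by (simp add: scaleC_minus_left)
  have "adj w = - w"
    by (simp add: w_def algebra_simps)
  then have "adj y = y"
    by (simp add: y_def scaleC_minus_left scaleC_minus_right)
  moreover have "adj x = x"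
    by (simp add: x_def add.commute)
  moreover have "adj b * b + b * adj b = 2 *\<^sub>R (x * x + y * y)"
  proof -
    have "x * x = (1 / 4) *\<^sub>R ((b + adj b) * (b + adj b))"
      "w * w = (1 / 4) *\<^sub>R ((b - adj b) * (b - adj b))"
      by (simp_all add: x_def w_def)
    then have "x * x + y * y
        = (1 / 4) *\<^sub>R ((b + adj b) * (b + adj b) - (b - adj b) * (b - adj b))"
      unfolding yy by (simp add: scaleR_diff_right)
    also have "(b + adj b) * (b + adj b) - (b - adj b) * (b - adj b)
        = 2 *\<^sub>R (adj b * b + b * adj b)"
      by (simp add: algebra_simps scaleR_2)
    finally show ?thesis by simp
  qed
  ultimately show ?thesis
    using that by blast
qed

text \<open>Adding \<open>- (adj b * b)\<close> to the sum of squares shows that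
  \<open>b * adj b\<close> is positive. Interchanging the factors preserves invertibility of
  positive shifts, so \<open>adj b * b\<close> is positive too, and antisymmetry applies.\<close>

lemma eq_0_of_minus_adj_mult_self_pos:
  fixes b :: "'a::unital_cstar_algebra"
  assumes "pos (- (adj b * b))"
  shows "b = 0"
proof -
  obtain x y where xy: "adj x = x" "adj y = y" "adj b * b + b * adj b = 2 *\<^sub>R (x * x + y * y)"
    by (rule adj_mult_self_sum)
  have "pos (2 *\<^sub>R (x * x + y * y) + - (adj b * b))"
    by (intro pos_add pos_scaleR pos_square assms xy(1,2)) simp
  then have bb: "pos (b * adj b)"
    unfolding xy(3)[symmetric] by simp
  have "pos (adj b * b)"
  proof (rule pos_of_spectrum)
    fix t :: real assume "t > 0"
    then show "two_sided_invertible (adj b * b + of_real t)"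
      using two_sided_invertible_mult_commute_add two_sided_invertible_pos_add[OF bb] by auto
  qed simp
  then show ?thesis
    using pos_antisym[OF _ assms] by simp
qed

text \<open>
  With \<open>h = a\<^sup>* a\<close>, the element \<open>n = |h| - h\<close> satisfies \<open>(a n)\<^sup>* (a n) = n h n = - n\<^sup>3 / 2\<close>,
  which forces \<open>n = 0\<close>.
\<close>

theorem pos_adj_mult_self: "pos (adj a * a)" for a :: "'a::unital_cstar_algebra"
proof -
  define h where "h = adj a * a"
  have h: "adj h = h"
    by (simp add: h_def)
  obtain k where k: "pos k" "k * k = h * h" "\<And>x. x * (h * h) = h * h * x \<Longrightarrow> x * k = k * x"
    using pos_root[OF pos_square[OF h]] by blast
  have hk: "h * k = k * h"
    by (rule k(3)) (simp add: mult.assoc)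
  define n where "n = k - h"
  have n: "pos n" "adj n = n"
    using pos_root_minus[OF h k(1,2) hk] by (simp_all add: n_def h pos_adj[OF k(1)])
  have nn: "n * n = - (2 *\<^sub>R (h * n))"
    by (simp add: n_def algebra_simps k(2) hk scaleR_2)
  have hn: "h * n = n * h"
    by (simp add: n_def algebra_simps hk)
  obtain x where x: "adj x = x" "n = x * x"
    using n(1) by (auto simp: pos_def)
  have "- (adj (a * n) * (a * n)) = - (n * (h * n))"
    by (simp add: n h_def mult.assoc)
  also have "\<dots> = (1 / 2) *\<^sub>R (n * (n * n))"
    by (simp add: nn)
  also have "n * (n * n) = (x * n) * (x * n)"
    by (simp add: x mult.assoc)
  finally have "- (adj (a * n) * (a * n)) = (1 / 2) *\<^sub>R ((x * n) * (x * n))" .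
  moreover have "pos ((1 / 2) *\<^sub>R ((x * n) * (x * n)))"
    by (intro pos_scaleR pos_square) (simp_all add: x mult.assoc)
  ultimately have "pos (- (adj (a * n) * (a * n)))"
    by simp
  then have "a * n = 0"
    by (rule eq_0_of_minus_adj_mult_self_pos)
  then have "h * n = 0"
    by (simp add: h_def mult.assoc)
  then have "n = 0"
    using nn norm_self_adjoint_square[OF n(2)] by simp
  then have "h = k"
    by (simp add: n_def)
  then show ?thesis
    using k(1) by (simp add: h_def)
qed

lemma pos_conj:
  fixes h :: "'a::unital_cstar_algebra"
  assumes "pos h"
  shows "pos (adj x * h * x)"
proof -
  obtain y where "adj y = y" "h = y * y"
    using assms by (auto simp: pos_def)
  then have "adj x * h * x = adj (y * x) * (y * x)"
    by (simp add: mult.assoc)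
  then show ?thesis
    using pos_adj_mult_self by metis
qed

section \<open>Positive elements and the spectrum\<close>

text \<open>The product of \<open>m + x\<close> with \<open>cnj m + x\<close> is
  \<open>(Re m + x)^2 + (Im m)^2\<close>, a square plus a positive scalar.\<close>

lemma two_sided_invertible_nonreal_shift:
  fixes x :: "'a::unital_cstar_algebra"
  assumes x: "adj x = x" and m: "Im m \<noteq> 0"
  shows "two_sided_invertible (m *\<^sub>C 1 + x)"
proof (rule two_sided_invertible_factor)
  define y where "y = of_real (Re m) + x"
  have r1: "complex_of_real r *\<^sub>C 1 = (of_real r :: 'a)" for r
    unfolding scaleC_complex_of_real by (simp add: of_real_def)
  have m1: "m *\<^sub>C 1 = (of_real (Re m) :: 'a) + (\<i> * of_real (Im m)) *\<^sub>C 1"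
    unfolding r1[symmetric] scaleC_add_left[symmetric] complex_eq[symmetric] ..
  have "cnj m = of_real (Re m) + - (\<i> * of_real (Im m))"
    by (simp add: complex_eq_iff)
  note c = this
  have m2: "cnj m *\<^sub>C 1 = (of_real (Re m) :: 'a) - (\<i> * of_real (Im m)) *\<^sub>C 1"
    unfolding c scaleC_add_left scaleC_minus_left r1 by simp
  define j where "j = ((\<i> * of_real (Im m)) *\<^sub>C 1 :: 'a)"
  have jy: "j * z = z * j" for z
    by (simp add: j_def scaleC_mult_left scaleC_mult_right)
  have jj: "j * j = - of_real ((Im m)\<^sup>2)"
  proof -
    have "(\<i> * of_real (Im m)) * (\<i> * of_real (Im m)) = - complex_of_real ((Im m)\<^sup>2)"
      by (simp add: complex_eq_iff power2_eq_square)
    then have "j * j = (- of_real ((Im m)\<^sup>2)) *\<^sub>C 1"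
      unfolding j_def scaleC_mult_left scaleC_mult_right scaleC_scaleC by simp
    then show ?thesis
      by (simp only: scaleC_minus_left r1)
  qed
  have 1: "m *\<^sub>C 1 + x = y + j" "cnj m *\<^sub>C 1 + x = y - j"
    by (simp_all add: m1 m2 y_def j_def)
  have "(y + j) * (y - j) = y * y + of_real ((Im m)\<^sup>2)"
    using jj by (simp add: algebra_simps jy[of y])
  moreover have "two_sided_invertible (y * y + of_real ((Im m)\<^sup>2))"
    using m by (intro two_sided_invertible_pos_add pos_square) (simp_all add: y_def x)
  ultimately show "two_sided_invertible ((m *\<^sub>C 1 + x) * (cnj m *\<^sub>C 1 + x))"
    unfolding 1 by simp
  show "(m *\<^sub>C 1 + x) * (cnj m *\<^sub>C 1 + x) = (cnj m *\<^sub>C 1 + x) * (m *\<^sub>C 1 + x)"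
    unfolding 1 by (simp add: algebra_simps jy[of y])
qed

text \<open>For the converse direction, a complex \<open>z\<close> outside the nonnegative reals has
  a nonreal square root \<open>m\<close>, and \<open>z - x * x\<close> factors as
  \<open>(m + x) * (m - x)\<close> with both factors invertible.\<close>

lemma positive_element_iff_pos: "positive_element h \<longleftrightarrow> pos h"
  for h :: "'a::unital_cstar_algebra"
proof
  assume h: "positive_element h"
  show "pos h"
  proof (rule pos_of_spectrum)
    show "adj h = h"
      using h by (simp add: positive_element_def)
    fix t :: real assume "t > 0"
    then have "complex_of_real (- t) \<notin> spectrum h"
      using h by (auto simp: positive_element_def simp del: of_real_minus)
    then have "two_sided_invertible (complex_of_real (- t) *\<^sub>C 1 - h)"
      unfolding spectrum_def by blast
    moreover have "(- t) *\<^sub>R 1 = (- of_real t :: 'a)"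
      by (simp add: of_real_def)
    then have "complex_of_real (- t) *\<^sub>C 1 - h = - (h + of_real t)"
      unfolding scaleC_complex_of_real by simp
    ultimately have "two_sided_invertible (- (h + of_real t))"
      by metis
    then show "two_sided_invertible (h + of_real t)"
      by (simp only: two_sided_invertible_minus_iff)
  qed
next
  assume h: "pos h"
  then obtain x where x: "adj x = x" "h = x * x"
    by (auto simp: pos_def)
  have "z \<in> complex_of_real ` {0..}" if z: "z \<in> spectrum h" for z
  proof (rule ccontr)
    assume nz: "z \<notin> complex_of_real ` {0..}"
    define m where "m = csqrt z"
    have m: "m * m = z"
      by (simp add: m_def flip: power2_eq_square)
    have im: "Im m \<noteq> 0"
    proof
      assume "Im m = 0"
      then have "m = complex_of_real (Re m)"
        by (simp add: complex_eq_iff)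
      then have "z = complex_of_real ((Re m)\<^sup>2)"
        using m by (metis of_real_mult power2_eq_square)
      moreover have "(Re m)\<^sup>2 \<in> {0..}"
        by simp
      ultimately show False
        using nz by (metis image_eqI)
    qed
    have "two_sided_invertible ((m *\<^sub>C 1 + x) * (m *\<^sub>C 1 + - x))"
      using x(1) im by (intro two_sided_invertible_mult two_sided_invertible_nonreal_shift) simp_all
    also have "(m *\<^sub>C 1 + x) * (m *\<^sub>C 1 + - x) = z *\<^sub>C 1 - h"
      by (simp add: algebra_simps x(2) scaleC_mult_left scaleC_mult_right scaleC_scaleC m
          scaleC_add_right)
    finally show False
      using z by (simp add: spectrum_def)
  qed
  then show "positive_element h"
    using h by (auto simp: positive_element_def pos_adj)
qed

text \<open>In the commuting case \<open>d = h - k\<close> satisfies \<open>d * (h + k) = 0\<close>,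
  so the positive elements \<open>d * h * d\<close> and \<open>d * k * d\<close> are negatives of
  each other. Both vanish, \<open>d^3 = 0\<close> and hence \<open>d = 0\<close>. In general, the
  root \<open>r\<close> of \<open>h * h\<close> commutes with both \<open>h\<close> and
  \<open>k\<close>, so both equal \<open>r\<close>.\<close>

lemma pos_root_unique:
  fixes h k :: "'a::unital_cstar_algebra"
  assumes h: "pos h" and k: "pos k" and eq: "h * h = k * k"
  shows "h = k"
proof -
  have *: "h = k" if h: "pos h" and k: "pos k" and eq: "h * h = k * k" and hk: "h * k = k * h"
    for h k :: 'a
  proof -
    define d where "d = h - k"
    have d: "adj d = d"
      using h k by (simp add: d_def pos_adj)
    have "d * (h + k) = 0"
      by (simp add: d_def algebra_simps eq hk)
    then have 0: "d * h * d = - (d * k * d)"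
      by (metis distrib_left distrib_right mult_zero_left eq_neg_iff_add_eq_0)
    have p: "pos (d * h * d)" "pos (d * k * d)"
      using pos_conj[of _ d] h k d by auto
    have "d * h * d = 0" "d * k * d = 0"
      using pos_antisym[OF p(1)] pos_antisym[OF p(2)] p 0 by simp_all
    moreover have "d * d * d = d * h * d - d * k * d"
      by (simp add: d_def algebra_simps)
    ultimately have "d * d * d = 0"
      by simp
    then have "d * d * (d * d) = 0"
      by (simp flip: mult.assoc)
    moreover have "adj (d * d) = d * d"
      by (simp add: d)
    ultimately have "d * d = 0"
      using norm_self_adjoint_square[of "d * d"] by simp
    then have "d = 0"
      using norm_self_adjoint_square[OF d] by simp
    then show ?thesis
      by (simp add: d_def)
  qed
  have "pos (h * h)"
    by (rule pos_square) (simp add: h pos_adj)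
  then obtain r where r: "pos r" "r * r = h * h" "\<And>x. x * (h * h) = h * h * x \<Longrightarrow> x * r = r * x"
    using pos_root by blast
  have "h = r"
    by (rule *[OF h r(1)]) (simp_all add: r mult.assoc)
  moreover have "k * r = r * k"
    by (rule r(3)) (simp add: eq mult.assoc)
  then have "k = r"
    by (intro *[OF k r(1)]) (simp_all add: r eq)
  ultimately show ?thesis by simp
qed

section \<open>The absolute value and its continuity\<close>

lemma abs_element_eqI:
  assumes "pos k" "k * k = adj a * a"
  shows "abs_element a = k"
  unfolding abs_element_def positive_element_iff_pos
  by (rule the_equality) (auto simp: assms intro: pos_root_unique[OF _ assms(1)])

lemma abs_element:
  fixes a :: "'a::unital_cstar_algebra"
  shows pos_abs_element: "pos (abs_element a)"
    and abs_element_square: "abs_element a * abs_element a = adj a * a"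
proof -
  obtain k where "pos k" "k * k = adj a * a"
    using pos_root[OF pos_adj_mult_self] by blast
  then show "pos (abs_element a)" "abs_element a * abs_element a = adj a * a"
    using abs_element_eqI by auto
qed

lemma adj_abs_element [simp]: "adj (abs_element a) = abs_element a"
  by (rule pos_adj[OF pos_abs_element])

lemma abs_element_mult_eq_0_iff: "abs_element a * x = 0 \<longleftrightarrow> a * x = 0"
proof -
  have "adj (abs_element a * x) * (abs_element a * x) = adj (a * x) * (a * x)"
    by (simp add: mult.assoc) (simp add: abs_element_square flip: mult.assoc)
  then show ?thesis
    by (metis adj_mult_self_eq_0)
qed

text \<open>For all \<open>b\<close> with \<open>norm b < norm a + 1\<close> the same scalar
  \<open>s\<close> can be used in the power series, so \<open>abs_element\<close> is there a
  composition of continuous maps.\<close>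

lemma tendsto_abs_element:
  fixes f :: "'b \<Rightarrow> 'a::unital_cstar_algebra"
  assumes f: "(f \<longlongrightarrow> a) F"
  shows "((\<lambda>x. abs_element (f x)) \<longlongrightarrow> abs_element a) F"
proof -
  define s where "s = (norm a + 1)\<^sup>2"
  have s: "s > 0"
    unfolding s_def by (intro zero_less_power add_nonneg_pos) auto
  define g where "g b = 1 - (1 / s) *\<^sub>R (adj b * b)" for b :: 'a
  have near: "g b \<in> cball 0 1 \<and> abs_element b = sqrt s *\<^sub>R sqrt_one_minus (g b)"
    if "norm b < norm a + 1" for b
  proof -
    have "norm (adj b * b) \<le> s"
      unfolding cstar_identity s_def using that by (intro power_mono) auto
    then have n: "norm (of_real s - adj b * b) \<le> s"
      by (intro norm_of_real_minus_pos pos_adj_mult_self)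
    have a: "adj (adj b * b) = adj b * b" by simp
    note * = a n s
    have "abs_element b = root_at s (adj b * b)"
      by (rule abs_element_eqI[OF pos_root_at[OF *] root_at_square[OF *]])
    then show ?thesis
      using norm_root_arg[OF *] by (simp add: root_at_def g_def)
  qed
  have "((\<lambda>x. norm (f x)) \<longlongrightarrow> norm a) F"
    by (intro tendsto_intros f)
  then have ev: "eventually (\<lambda>x. norm (f x) < norm a + 1) F"
    by (rule order_tendstoD) simp
  have "((\<lambda>x. g (f x)) \<longlongrightarrow> g a) F"
    unfolding g_def by (intro tendsto_intros f)
  then have "((\<lambda>x. sqrt_one_minus (g (f x))) \<longlongrightarrow> sqrt_one_minus (g a)) F"
    by (rule continuous_on_tendsto_compose[OF continuous_on_sqrt_one_minus])
      (use near[of a] eventually_mono[OF ev] near in auto)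
  then have "((\<lambda>x. sqrt s *\<^sub>R sqrt_one_minus (g (f x))) \<longlongrightarrow> abs_element a) F"
    using near[of a] by (auto intro: tendsto_intros)
  then show ?thesis
    by (rule Lim_transform_eventually) (use ev near in \<open>auto elim: eventually_mono\<close>)
qed


section \<open>Support projections and polar decomposition\<close>

lemma is_projectionD:
  assumes "is_projection p"
  shows "adj p = p" "p * p = p" "p * (p * x) = p * x"
  using assms by (simp_all add: is_projection_def flip: mult.assoc)

lemma is_projection_complement:
  fixes p :: "'a::unital_cstar_algebra"
  assumes "is_projection p"
  shows "is_projection (1 - p)"
  using assms by (simp add: is_projection_def algebra_simps)

lemma pos_projection: "is_projection p \<Longrightarrow> pos p"
  unfolding pos_def by (metis is_projectionD(1,2))

lemma projection_norm_le_1: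
  fixes p :: "'a::unital_cstar_algebra"
  assumes "is_projection p"
  shows "norm p \<le> 1"
proof -
  have "norm p * norm p = norm p"
    using norm_self_adjoint_square[of p] is_projectionD[OF assms] by (simp add: power2_eq_square)
  then show ?thesis by auto
qed

lemma pos_of_real_minus:
  fixes h :: "'a::unital_cstar_algebra"
  assumes "adj h = h" "norm h \<le> M" "M > 0"
  shows "pos (of_real M - h)"
  by (rule posI[of _ M]) (use assms in simp_all)

lemma two_sided_invertible_block:
  fixes p :: "'a::unital_cstar_algebra"
  assumes p: "is_projection p"
    and x: "two_sided_invertible x" "x * p = p * x"
    and y: "two_sided_invertible y" "y * p = p * y"
  shows "two_sided_invertible (x * p + y * (1 - p))"
proof -
  define x' y' where "x' = inv_elt x" and "y' = inv_elt y"
  have c: "x' * p = p * x'" "y' * p = p * y'"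
    unfolding x'_def y'_def using x y by (auto intro: inv_elt_commute)
  have block: "(v * p + w * (1 - p)) * (v' * p + w' * (1 - p)) = v * v' * p + w * w' * (1 - p)"
    if "v' * p = p * v'" "w' * p = p * w'" for v w v' w'
  proof -
    have "p * (v' * p) = v' * p" "p * (w' * p) = w' * p" "p * w' = w' * p" "p * v' = v' * p"
      using that is_projectionD[OF p] by (simp_all flip: mult.assoc)
    then show ?thesis
      by (simp add: algebra_simps is_projectionD[OF p])
  qed
  have "(x * p + y * (1 - p)) * (x' * p + y' * (1 - p)) = 1"
    "(x' * p + y' * (1 - p)) * (x * p + y * (1 - p)) = 1"
    by (simp_all only: block[OF c] block[OF x(2) y(2)])
      (simp_all add: x'_def y'_def inv_elt x(1) y(1))
  then show ?thesis
    by (auto simp: two_sided_invertible_def)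
qed

text \<open>The condition \<open>p = w * a\<close> makes \<open>a\<close> left invertible on the
  range of \<open>p\<close>. It encodes closed range algebraically: such a \<open>p\<close> exists
  exactly when \<open>a\<close> has closed range, as the lemmas below show.\<close>

definition right_support :: "'a::unital_cstar_algebra \<Rightarrow> 'a \<Rightarrow> bool" where
  "right_support a p \<longleftrightarrow> is_projection p \<and> a * p = a \<and> (\<exists>w. p = w * a)"

lemma mult_eq_of_square_mult_eq:
  fixes a :: "'a::unital_cstar_algebra"
  assumes "is_projection q" "adj a * a * q = adj a * a"
  shows "a * q = a"
proof -
  have "adj (a * (1 - q)) * (a * (1 - q)) = (1 - q) * (adj a * a - adj a * a * q)"
    by (simp add: is_projectionD[OF assms(1)] algebra_simps)
  also have "\<dots> = 0"
    by (simp add: assms(2))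
  finally have "a * (1 - q) = 0"
    by (simp only: adj_mult_self_eq_0)
  then show ?thesis
    by (simp add: algebra_simps)
qed

lemma projection_mult_commuted:
  assumes "is_projection p" "adj h = h" "p * h = h"
  shows "h * p = h"
  by (metis adj_mult assms is_projectionD(1))

text \<open>From \<open>p = w * a\<close> follows
  \<open>p = adj a * (adj w * w) * a <= M (adj a * a)\<close>. So \<open>adj a * a\<close> is at
  least \<open>1 / M\<close> on \<open>p\<close>, and the summand \<open>1 - p\<close> takes care of
  the complement because \<open>M >= 1\<close>.\<close>

lemma right_support_lower_bound:
  fixes a :: "'a::unital_cstar_algebra"
  assumes "right_support a p"
  obtains d where "d > 0" "pos (adj a * a + (1 - p) - of_real d)"
proof -
  obtain w where p: "is_projection p" "p = w * a"
    using assms by (auto simp: right_support_def)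
  define M where "M = (norm w)\<^sup>2 + 1"
  have M: "M \<ge> 1"
    by (simp add: M_def)
  have "pos (of_real M - adj w * w)"
    by (rule pos_of_real_minus) (simp_all add: cstar_identity M_def add_nonneg_pos)
  then have "pos (adj a * (of_real M - adj w * w) * a)"
    by (rule pos_conj)
  moreover have "adj a * (of_real M - adj w * w) * a = M *\<^sub>R (adj a * a) - p"
  proof -
    have "p = adj p * p"
      using is_projectionD[OF p(1)] by simp
    also have "\<dots> = adj a * (adj w * w) * a"
      by (simp add: p(2) mult.assoc)
    finally show ?thesis
      by (simp add: algebra_simps of_real_def)
  qed
  ultimately have "pos ((1 / M) *\<^sub>R (M *\<^sub>R (adj a * a) - p) + (1 - 1 / M) *\<^sub>R (1 - p))"
    using M pos_projection[OF is_projection_complement[OF p(1)]]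
    by (intro pos_add pos_scaleR) simp_all
  also have "(1 / M) *\<^sub>R (M *\<^sub>R (adj a * a) - p) + (1 - 1 / M) *\<^sub>R (1 - p)
      = adj a * a + (1 - p) - of_real (1 / M)"
    using M by (simp add: algebra_simps of_real_def)
  finally show ?thesis
    using M by (intro that[of "1 / M"]) auto
qed

lemma two_sided_invertible_of_lower_bound:
  fixes h :: "'a::unital_cstar_algebra"
  assumes "pos (h - of_real d)" "s < d"
  shows "two_sided_invertible (h - of_real s)"
  using two_sided_invertible_pos_add[OF assms(1), of "d - s"] assms(2) by simp

lemma closed_range_altdef:
  fixes a :: "'a::unital_cstar_algebra"
  shows "closed_range a \<longleftrightarrow>
     (\<exists>\<epsilon>>0. \<forall>s. 0 < s \<and> s < \<epsilon> \<longrightarrow> two_sided_invertible (of_real s - adj a * a))"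
proof -
  have 1: "complex_of_real s \<notin> spectrum x \<longleftrightarrow> two_sided_invertible (of_real s - x)"
    for s and x :: 'a
  proof -
    have "complex_of_real s *\<^sub>C 1 = (of_real s :: 'a)"
      unfolding scaleC_complex_of_real by (simp add: of_real_def)
    then show ?thesis
      by (simp add: spectrum_def)
  qed
  have "spectrum x \<inter> complex_of_real ` {0<..<\<epsilon>} = {}
      \<longleftrightarrow> (\<forall>s. 0 < s \<and> s < \<epsilon> \<longrightarrow> complex_of_real s \<notin> spectrum x)" for \<epsilon> and x :: 'a
    by auto
  then show ?thesis
    unfolding closed_range_def 1[symmetric] by simp
qed

text \<open>For \<open>s\<close> below the lower bound \<open>d\<close>,
  \<open>s - adj a * a\<close> is block diagonal for \<open>p\<close>: on \<open>p\<close> it agrees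
  with the invertible \<open>s - (adj a * a + (1 - p))\<close>, and on \<open>1 - p\<close> it is
  the nonzero scalar \<open>s\<close>.\<close>

lemma right_support_imp_closed_range:
  fixes a :: "'a::unital_cstar_algebra"
  assumes "right_support a p"
  shows "closed_range a"
proof -
  have p: "is_projection p" "a * p = a"
    using assms by (auto simp: right_support_def)
  define h where "h = adj a * a"
  have hp: "h * p = h"
    by (simp add: h_def p mult.assoc)
  then have ph: "p * h = h"
    using p h_def by (metis adj_adj adj_mult is_projectionD(1))
  obtain d where d: "d > 0" "pos (h + (1 - p) - of_real d)"
    using right_support_lower_bound[OF assms] by (auto simp: h_def)
  have "two_sided_invertible (of_real s - h)" if s: "0 < s" "s < d" for s
  proof -
    define x where "x = - (h + (1 - p) - of_real s)"
    have x: "two_sided_invertible x"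
      unfolding x_def two_sided_invertible_minus_iff
      by (rule two_sided_invertible_of_lower_bound[OF d(2) s(2)])
    have y: "two_sided_invertible (of_real s :: 'a)"
      using two_sided_invertible_scaleR[OF two_sided_invertible_1, of s] s by (simp add: of_real_def)
    have "two_sided_invertible (x * p + of_real s * (1 - p))"
      by (rule two_sided_invertible_block[OF p(1) x _ y])
        (simp_all add: x_def algebra_simps hp ph is_projectionD[OF p(1)] of_real_commute)
    also have "x * p + of_real s * (1 - p) = of_real s - h"
      by (simp add: x_def algebra_simps hp is_projectionD[OF p(1)])
    finally show ?thesis .
  qed
  then show ?thesis
    unfolding closed_range_altdef using d(1) by (auto simp: h_def)
qed

text \<open>
  The projection is the spectral projection of \<open>a\<^sup>* a\<close> for the part of the spectrum above the
  gap, \<open>(1 + x) / 2\<close> with \<open>x\<close> the sign of \<open>a\<^sup>* a - t\<close> and \<open>t\<close> in the gap.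
\<close>

lemma closed_range_imp_right_support:
  fixes a :: "'a::unital_cstar_algebra"
  assumes "closed_range a"
  obtains p where "right_support a p"
proof -
  define h where "h = adj a * a"
  have h: "adj h = h"
    by (simp add: h_def)
  obtain e where e: "e > 0" "\<And>s. 0 < s \<Longrightarrow> s < e \<Longrightarrow> two_sided_invertible (of_real s - h)"
    using assms unfolding closed_range_altdef h_def by blast
  define t where "t = e / 2"
  have t: "0 < t" "t < e"
    using e(1) by (simp_all add: t_def)
  define f where "f = h - of_real t"
  have f: "adj f = f"
    by (simp add: f_def h)
  have "two_sided_invertible (- f)"
    using e(2)[OF t] by (simp add: f_def)
  then have iv: "two_sided_invertible f"
    by simp
  obtain k where k: "pos k" "k * k = f * f" "\<And>x. x * (f * f) = f * f * x \<Longrightarrow> x * k = k * x"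
    using pos_root[OF pos_square[OF f]] by blast
  have fk: "f * k = k * f"
    by (rule k(3)) (simp add: mult.assoc)
  have ik: "two_sided_invertible k"
    by (rule two_sided_invertible_factor[of k k])
      (simp_all add: k(2) two_sided_invertible_mult iv)
  define l where "l = inv_elt k"
  have l: "k * l = 1" "l * k = 1" "k * (l * z) = z" "l * (k * z) = z" for z
    unfolding l_def by (simp_all add: inv_elt[OF ik] inv_elt_cancel[OF ik])
  have lf: "l * f = f * l"
    unfolding l_def by (rule inv_elt_commute[OF ik fk[symmetric]])
  have al: "adj l = l"
    using inv_elt_adj[OF ik] pos_adj[OF k(1)] by (simp add: l_def)
  define x where "x = f * l"
  have "x * x = f * (l * f) * l"
    by (simp add: x_def mult.assoc)
  also have "\<dots> = (f * f) * (l * l)"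
    unfolding lf by (simp only: mult.assoc)
  also have "\<dots> = 1"
    by (simp add: k(2)[symmetric] mult.assoc l)
  finally have xx: "x * x = 1" .
  have xl: "x * l = l * x" "x * f = f * x"
    by (simp_all add: x_def mult.assoc lf) (simp add: lf flip: mult.assoc)
  have kx: "k * x = f"
    by (simp add: x_def fk[symmetric] l flip: mult.assoc) (simp add: mult.assoc l)
  have xk: "x * k = f"
    by (simp add: x_def mult.assoc l)
  define p where "p = (1 / 2) *\<^sub>R (1 + x)"
  have "adj x = x"
    by (simp add: x_def f al lf)
  then have ap: "adj p = p"
    by (simp add: p_def)
  have p: "is_projection p"
    unfolding is_projection_def using ap
    by (simp add: p_def algebra_simps xx flip: scaleR_left_distrib)
  have xh: "x * h = h * x"
  proof -
    have "h = f + of_real t"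
      by (simp add: f_def)
    then show ?thesis
      by (simp add: algebra_simps xl of_real_commute)
  qed
  have hp: "h * p = p * h"
    by (simp add: p_def algebra_simps xh)
  have kp: "k * p = p * k"
    by (simp add: p_def algebra_simps kx xk)
  have fp: "f * p = k * p"
  proof -
    have "f * x = k"
      using xx by (simp add: kx[symmetric] mult.assoc)
    then show ?thesis
      by (simp add: p_def algebra_simps kx)
  qed
  have fq: "f * (1 - p) = - (k * (1 - p))"
  proof -
    have "f + k = 2 *\<^sub>R (k * p)"
      by (simp add: p_def algebra_simps kx)
    then show ?thesis
      by (simp add: algebra_simps fp scaleR_2)
  qed
  define q where "q = 1 - p"
  have q: "is_projection q"
    unfolding q_def by (rule is_projection_complement[OF p])
  have hq: "h * q = q * h" "k * q = q * k"
    by (simp_all add: q_def algebra_simps hp kp)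
  \<comment> \<open>The part of \<open>h\<close> off \<open>p\<close>. It satisfies
    \<open>0 <= m <= t\<close>, since \<open>f\<close> is \<open>- k\<close> on
    \<open>q\<close>.\<close>
  define m where "m = h * q"
  have conj: "pos (z * q)" if "pos z" "z * q = q * z" for z
    using pos_conj[OF that(1), of q] that(2) is_projectionD[OF q] by (simp add: mult.assoc)
  have m: "pos m"
    unfolding m_def by (rule conj) (use hq in \<open>simp_all add: h_def pos_adj_mult_self\<close>)
  have "of_real t - m = t *\<^sub>R p + k * q"
  proof -
    have "m = f * q + t *\<^sub>R q"
      by (simp add: m_def f_def algebra_simps of_real_def)
    then have "m = t *\<^sub>R q - k * q"
      using fq by (simp add: q_def)
    then show ?thesis
      by (simp add: q_def algebra_simps of_real_def)
  qed
  then have "pos (of_real t - m)"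
    using t(1) by (simp only:) (intro pos_add pos_scaleR pos_projection[OF p] conj[OF k(1) hq(2)]; simp)
  then have mt: "norm m \<le> t"
    using t by (intro norm_le_of_pos m) auto
  \<comment> \<open>Otherwise \<open>norm m\<close> would be a spectral value of \<open>m\<close>
    lying in the gap of \<open>h\<close>, whereas the block form makes \<open>norm m - m\<close>
    invertible.\<close>
  have "m = 0"
  proof (rule ccontr)
    assume "m \<noteq> 0"
    define s where "s = norm m"
    have s: "0 < s" "s < e"
      using \<open>m \<noteq> 0\<close> mt t by (auto simp: s_def)
    have i: "two_sided_invertible (of_real s :: 'a)"
      using two_sided_invertible_scaleR[OF two_sided_invertible_1, of s] s by (simp add: of_real_def)
    have "two_sided_invertible ((of_real s - h) * q + of_real s * (1 - q))"
      by (rule two_sided_invertible_block[OF q e(2)[OF s] _ i])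
        (simp_all add: algebra_simps hq of_real_commute)
    also have "(of_real s - h) * q + of_real s * (1 - q) = of_real s - m"
      by (simp add: m_def algebra_simps)
    finally show False
      using norm_in_spectrum[OF m \<open>m \<noteq> 0\<close>] by (simp add: s_def)
  qed
  then have hp': "h * p = h"
    by (simp add: m_def q_def algebra_simps)
  have "a * p = a"
    by (rule mult_eq_of_square_mult_eq[OF p]) (use hp' h_def in simp)
  \<comment> \<open>As \<open>f\<close> and \<open>k\<close> agree on \<open>p\<close>, this is
    \<open>h * p + (1 - p)\<close>. Then \<open>g * p = h\<close>, and inverting \<open>g\<close>
    exhibits \<open>p\<close> as a left multiple of \<open>a\<close>.\<close>
  define g where "g = (k + of_real t) * p + 1 * (1 - p)"
  have ig: "two_sided_invertible g"
    unfolding g_def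
    by (rule two_sided_invertible_block[OF p two_sided_invertible_pos_add[OF k(1) t(1)] _ two_sided_invertible_1])
      (simp_all add: algebra_simps kp of_real_commute)
  have g: "g = h * p + (1 - p)"
    by (simp add: g_def distrib_right fp[symmetric]) (simp add: f_def algebra_simps)
  have "g * p = h"
    unfolding g by (simp add: algebra_simps hp' is_projectionD[OF p])
  then have "p = inv_elt g * adj a * a"
    using inv_elt_cancel(2)[OF ig, of p] by (simp add: h_def mult.assoc)
  then show ?thesis
    using p \<open>a * p = a\<close> by (intro that[of p]) (auto simp: right_support_def)
qed

section \<open>Partial isometries and the polar part\<close>

lemma partial_isometry:
  fixes u :: "'a::unital_cstar_algebra"
  assumes p: "is_projection p" and u: "adj u * u = p"
  shows "u * p = u" "p * adj u = adj u" "is_projection (u * adj u)"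
proof -
  note pp = is_projectionD[OF p]
  show up: "u * p = u"
    by (rule mult_eq_of_square_mult_eq[OF p]) (simp add: u pp)
  show "p * adj u = adj u"
    using arg_cong[OF up, of adj] by (simp add: pp)
  have "(u * adj u) * (u * adj u) = u * (adj u * u) * adj u"
    by (simp only: mult.assoc)
  also have "\<dots> = u * adj u"
    unfolding u by (simp add: up)
  finally show "is_projection (u * adj u)"
    by (simp add: is_projection_def)
qed

context
  fixes a p :: "'a::unital_cstar_algebra"
  assumes ap: "right_support a p"
begin

lemma support_projection: "is_projection p"
  using ap by (simp add: right_support_def)

lemma abs_element_support:
  shows "abs_element a * p = abs_element a" "p * abs_element a = abs_element a"
proof -
  have "abs_element a * (1 - p) = 0"
    unfolding abs_element_mult_eq_0_iff using ap by (simp add: right_support_def algebra_simps)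
  then show 1: "abs_element a * p = abs_element a"
    by (simp add: algebra_simps)
  show "p * abs_element a = abs_element a"
    using arg_cong[OF 1, of adj] is_projectionD[OF support_projection] by simp
qed

text \<open>Its square is \<open>adj a * a + (1 - p)\<close>, which has a positive lower
  bound.\<close>

lemma two_sided_invertible_abs_support: "two_sided_invertible (abs_element a + (1 - p))"
proof -
  let ?g = "abs_element a + (1 - p)"
  have gg: "?g * ?g = adj a * a + (1 - p)"
    by (simp add: algebra_simps abs_element_support abs_element_square
        is_projectionD[OF support_projection])
  obtain d where d: "d > 0" "pos (adj a * a + (1 - p) - of_real d)"
    using right_support_lower_bound[OF ap] .
  have "two_sided_invertible (?g * ?g)"
    unfolding gg using two_sided_invertible_of_lower_bound[OF d(2), of 0] d(1) by simp
  then show ?thesis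
    by (rule two_sided_invertible_factor) simp
qed

text \<open>With \<open>g = abs_element a + (1 - p)\<close>, the candidate
  \<open>u = a * inv_elt g\<close> has the required properties because \<open>p = w * a\<close>
  makes \<open>p\<close> the least projection fixing \<open>adj a * a\<close>. For another candidate
  \<open>v\<close>, leastness forces \<open>adj v * v = p\<close>; then
  \<open>v * (1 - p) = 0\<close>, so \<open>v * g = a\<close> and \<open>v = u\<close>.\<close>

lemma
  shows polar_part_eq: "polar_part a = a * inv_elt (abs_element a + (1 - p))"
    and adj_polar_part_mult: "adj (polar_part a) * polar_part a = p"
    and polar_part_mult_abs: "polar_part a * abs_element a = a"
proof -
  define k where "k = abs_element a"
  define g where "g = k + (1 - p)"
  define u where "u = a * inv_elt g"
  note p = is_projectionD[OF support_projection]
  have k: "k * p = k" "p * k = k" "k * k = adj a * a" "adj k = k"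
    by (simp_all add: k_def abs_element_support abs_element_square)
  have ig: "two_sided_invertible g"
    unfolding g_def k_def by (rule two_sided_invertible_abs_support)
  have ag: "adj (inv_elt g) = inv_elt g"
    using inv_elt_adj(2)[OF ig] by (simp add: g_def k p)
  have gp: "g * p = k" "p * g = k" "k * g = k * k"
    by (simp_all add: g_def algebra_simps k p)
  have "adj u * u = inv_elt g * (adj a * a) * inv_elt g"
    by (simp add: u_def ag mult.assoc)
  also have "\<dots> = inv_elt g * (g * p * g) * inv_elt g"
    by (simp add: gp k)
  also have "\<dots> = p"
    by (simp add: mult.assoc inv_elt_cancel inv_elt ig)
  finally have uu: "adj u * u = p" .
  have uk: "u * k = a"
    using ap by (simp add: u_def gp(1)[symmetric] mult.assoc inv_elt_cancel ig)
      (simp add: right_support_def)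
  have ph: "p * (adj a * a) = adj a * a"
    by (simp add: k(3)[symmetric] k(2) flip: mult.assoc)
  have min: "q * p = p" if q: "is_projection q" "q * (adj a * a) = adj a * a" for q
  proof -
    have "a * q = a"
      by (rule mult_eq_of_square_mult_eq[OF q(1) projection_mult_commuted[OF q(1) _ q(2)]]) simp
    moreover obtain w where "p = w * a"
      using ap by (auto simp: right_support_def)
    ultimately have "p * q = p"
      by (simp only: mult.assoc)
    then show ?thesis
      by (metis adj_mult p(1) is_projectionD(1)[OF q(1)])
  qed
  have "polar_part a = u"
    unfolding polar_part_def
  proof (rule the_equality)
    show "a = u * abs_element a \<and> is_range_projection (adj u * u) (adj a * a)"
      unfolding uu is_range_projection_def
      using uk[unfolded k_def, symmetric] min ph support_projection by blast
  next
    fix v assume "a = v * abs_element a \<and> is_range_projection (adj v * v) (adj a * a)"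
    then have v: "a = v * k" "is_range_projection (adj v * v) (adj a * a)"
      by (simp_all only: k_def)
    define r where "r = adj v * v"
    have r: "is_projection r" "r * (adj a * a) = adj a * a"
      "\<And>q. is_projection q \<Longrightarrow> q * (adj a * a) = adj a * a \<Longrightarrow> q * r = r"
      using v(2) by (auto simp: is_range_projection_def r_def)
    have "p * r = r" "r * p = p"
      by (rule r(3)[OF support_projection ph] min[OF r(1,2)])+
    then have "r = p"
      by (metis adj_mult p(1) is_projectionD(1)[OF r(1)])
    then have "v * p = v"
      using partial_isometry(1)[OF r(1)] by (simp add: r_def)
    then have "v * g = a"
      using v(1) by (simp add: g_def distrib_left right_diff_distrib)
    then show "v = u"
      by (auto simp: u_def mult.assoc inv_elt ig)
  qed
  then show "polar_part a = a * inv_elt (abs_element a + (1 - p))"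
    "adj (polar_part a) * polar_part a = p" "polar_part a * abs_element a = a"
    using uu uk by (simp_all add: u_def g_def k_def)
qed

end


section \<open>Extreme points of the unit ball\<close>

text \<open>With \<open>d = z - x\<close>, the convex combination of \<open>adj x * x\<close> and
  \<open>adj z * z\<close> equals \<open>p + t (1 - t) (adj d * d)\<close>, and it is at most 1 as
  \<open>x\<close> and \<open>z\<close> are contractions. Compressing to \<open>p\<close> leaves no
  room for \<open>d * p\<close>.\<close>

lemma convex_combination_support:
  fixes x z :: "'a::unital_cstar_algebra"
  assumes n: "norm x \<le> 1" "norm z \<le> 1" and t: "0 < t" "t < 1"
    and p: "is_projection p" and u: "u = (1 - t) *\<^sub>R x + t *\<^sub>R z" "adj u * u = p"
  shows "(z - x) * p = 0"
proof -
  note pp = is_projectionD[OF p]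
  define d where "d = z - x"
  have contr: "pos (1 - adj y * y)" if "norm y \<le> 1" for y :: 'a
    using pos_of_real_minus[of "adj y * y" 1] that by (simp add: cstar_identity power_le_one)
  have x: "x = u - t *\<^sub>R d" and z: "z = u + (1 - t) *\<^sub>R d"
    by (simp_all add: u d_def algebra_simps)
  have "(1 - t) *\<^sub>R (adj x * x) + t *\<^sub>R (adj z * z) = p + (t * (1 - t)) *\<^sub>R (adj d * d)"
  proof -
    have "(1 - t) *\<^sub>R (adj x * x) + t *\<^sub>R (adj z * z)
        = ((1 - t) + t) *\<^sub>R (adj u * u) + ((1 - t) * t\<^sup>2 + t * (1 - t)\<^sup>2) *\<^sub>R (adj d * d)"
      unfolding x z by (simp add: algebra_simps power2_eq_square)
    also have "(1 - t) * t\<^sup>2 + t * (1 - t)\<^sup>2 = t * (1 - t)"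
      by (simp add: algebra_simps power2_eq_square)
    finally show ?thesis
      by (simp add: u(2))
  qed
  then have "(1 - t) *\<^sub>R (1 - adj x * x) + t *\<^sub>R (1 - adj z * z)
      = 1 - (p + (t * (1 - t)) *\<^sub>R (adj d * d))"
    by (simp add: algebra_simps)
  moreover have "pos ((1 - t) *\<^sub>R (1 - adj x * x) + t *\<^sub>R (1 - adj z * z))"
    using t by (intro pos_add pos_scaleR contr n) auto
  ultimately have "pos (adj p * (1 - (p + (t * (1 - t)) *\<^sub>R (adj d * d))) * p)"
    by (intro pos_conj) simp
  also have "adj p * (1 - (p + (t * (1 - t)) *\<^sub>R (adj d * d))) * p
      = - ((t * (1 - t)) *\<^sub>R (adj (d * p) * (d * p)))"
    by (simp add: distrib_left distrib_right left_diff_distrib right_diff_distrib pp mult.assoc)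
  finally have "pos (- ((t * (1 - t)) *\<^sub>R (adj (d * p) * (d * p))))" .
  then have "pos ((1 / (t * (1 - t))) *\<^sub>R (- ((t * (1 - t)) *\<^sub>R (adj (d * p) * (d * p)))))"
    using t by (intro pos_scaleR) auto
  then have "pos (- (adj (d * p) * (d * p)))"
    using t by simp
  then show ?thesis
    unfolding d_def by (rule eq_0_of_minus_adj_mult_self_pos)
qed

text \<open>Kadison's criterion. A unit vector \<open>v\<close> in the corner is orthogonal to
  \<open>u\<close> on both sides, so \<open>u + v\<close> and \<open>u - v\<close> stay in the ball
  and \<open>u\<close> is their midpoint. Conversely, the difference of the end points of a segment
  through \<open>u\<close> lies in the corner.\<close>

lemma extreme_point_iff_corner_zero:
  fixes u :: "'a::unital_cstar_algebra"
  assumes p: "is_projection p" and u: "adj u * u = p"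
  shows "u extreme_point_of cball 0 1 \<longleftrightarrow> (\<forall>x. (1 - u * adj u) * x * (1 - p) = 0)"
proof
  note pp = is_projectionD[OF p] and pu = partial_isometry[OF p u]
  assume e: "u extreme_point_of cball 0 1"
  show "\<forall>x. (1 - u * adj u) * x * (1 - p) = 0"
  proof (rule ccontr)
    assume "\<not> ?thesis"
    then obtain x where x: "(1 - u * adj u) * x * (1 - p) \<noteq> 0" by blast
    define y where "y = (1 - u * adj u) * x * (1 - p)"
    define v where "v = (1 / norm y) *\<^sub>R y"
    have "y \<noteq> 0"
      using x by (simp add: y_def)
    then have nv: "norm v = 1"
      by (simp add: v_def)
    have "adj u * (1 - u * adj u) = 0"
      by (simp add: right_diff_distrib u pu flip: mult.assoc)
    then have "adj u * y = 0"
      by (simp add: y_def flip: mult.assoc)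
    then have uv: "adj u * v = 0"
      by (simp add: v_def)
    have vu: "adj v * u = 0"
      using arg_cong[OF uv, of adj] by simp
    have "y * (1 - p) = y"
      by (simp only: y_def mult.assoc is_projectionD(2)[OF is_projection_complement[OF p]])
    then have vp: "v * (1 - p) = v"
      by (simp add: v_def)
    have norm_le: "norm (u + w) \<le> 1" if w: "w = v \<or> w = - v" for w
    proof -
      have "adj (u + w) * (u + w) = p + adj v * v"
        using w by (auto simp: algebra_simps uv vu u)
      moreover have "norm (p + adj v * v) \<le> 1"
      proof (rule norm_le_of_pos)
        show "pos (p + adj v * v)"
          by (intro pos_add pos_projection p pos_adj_mult_self)
        have "pos (1 - adj v * v)"
          using pos_of_real_minus[of "adj v * v" 1] by (simp add: cstar_identity nv)
        then have "pos (adj (1 - p) * (1 - adj v * v) * (1 - p))"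
          by (rule pos_conj)
        also have "adj (1 - p) * (1 - adj v * v) * (1 - p)
            = (1 - p) * (1 - p) - adj (v * (1 - p)) * (v * (1 - p))"
          by (simp add: left_diff_distrib right_diff_distrib pp mult.assoc)
        also have "\<dots> = of_real 1 - (p + adj v * v)"
          unfolding vp by (simp add: algebra_simps pp)
        finally show "pos (of_real 1 - (p + adj v * v))" .
      qed simp
      ultimately have "(norm (u + w))\<^sup>2 \<le> 1"
        by (simp flip: cstar_identity)
      then show ?thesis
        by (simp add: power_le_one_iff abs_square_le_1)
    qed
    have "u + v \<in> cball 0 1" "u + - v \<in> cball 0 1"
      using norm_le[of v] norm_le[of "- v"] by simp_all
    moreover have "u \<in> open_segment (u + v) (u + - v)"
    proof -
      have "v \<noteq> 0"
        using nv by auto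
      have "v \<noteq> - v"
      proof
        assume "v = - v"
        then have "v + v = 0"
          by (simp only: eq_neg_iff_add_eq_0)
        then have "2 *\<^sub>R v = 0"
          by (simp only: scaleR_2)
        then show False
          using \<open>v \<noteq> 0\<close> by simp
      qed
      moreover have "u = (1 - 1 / 2) *\<^sub>R (u + v) + (1 / 2) *\<^sub>R (u + - v)"
        by (simp flip: scaleR_add_right)
      ultimately show ?thesis
        unfolding in_segment by (intro conjI exI[of _ "1 / 2"]) auto
    qed
    ultimately show False
      using e unfolding extreme_point_of_def by blast
  qed
next
  note pp = is_projectionD[OF p] and pu = partial_isometry[OF p u]
  define q where "q = u * adj u"
  have q: "is_projection q"
    using pu by (simp add: q_def)
  note qq = is_projectionD[OF q]
  assume c: "\<forall>x. (1 - u * adj u) * x * (1 - p) = 0"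
  have "(norm u)\<^sup>2 \<le> 1"
    using cstar_identity[of u] projection_norm_le_1[OF p] by (simp add: u)
  then have "norm u \<le> 1"
    by (simp add: abs_square_le_1)
  moreover have "u \<notin> open_segment x z" if n: "norm x \<le> 1" "norm z \<le> 1" for x z
  proof
    assume "u \<in> open_segment x z"
    then obtain t where t: "x \<noteq> z" "0 < t" "t < 1" "u = (1 - t) *\<^sub>R x + t *\<^sub>R z"
      unfolding in_segment by blast
    define d where "d = z - x"
    have dp: "d * p = 0"
      unfolding d_def by (rule convex_combination_support[OF n t(2,3) p t(4) u])
    \<comment> \<open>The same argument for the adjoints, whose convex combination
      \<open>adj u\<close> has initial projection \<open>q\<close>.\<close>
    have "(adj z - adj x) * q = 0"
      by (rule convex_combination_support[OF _ _ t(2,3) q, where u = "adj u"])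
        (use n in \<open>simp_all add: t(4) q_def\<close>)
    then have "adj ((adj z - adj x) * q) = 0"
      by simp
    then have qd: "q * d = 0"
      by (simp add: qq d_def)
    have "d = (1 - q) * d * (1 - p)"
      by (simp add: left_diff_distrib right_diff_distrib dp qd)
    also have "\<dots> = 0"
      using c by (simp add: q_def)
    finally show False
      using t(1) by (simp add: d_def)
  qed
  ultimately show "u extreme_point_of cball 0 1"
    by (simp add: extreme_point_of_def)
qed

section \<open>Stability at quasi-invertible elements\<close>

text \<open>
  With respect to \<open>p\<close> and \<open>q = u u\<^sup>*\<close> the element \<open>b\<close> is a \<open>2 \<times> 2\<close> block matrix whose
  \<open>(1 - q, 1 - p)\<close> corners all vanish. When its \<open>(q, p)\<close> corner is invertible with inverse \<open>c\<close>,
  the Schur complement vanishes too, so \<open>E = c b\<close> is an idempotent with \<open>b E = b\<close>. The support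
  projection of \<open>b\<close> is that of \<open>E\<close>.
\<close>

definition corner :: "'a::unital_cstar_algebra \<Rightarrow> 'a \<Rightarrow> 'a \<Rightarrow> 'a" where
  "corner u p b = adj u * b * p + (1 - p)"

definition corner_idem :: "'a::unital_cstar_algebra \<Rightarrow> 'a \<Rightarrow> 'a \<Rightarrow> 'a" where
  "corner_idem u p b = inv_elt (corner u p b) * adj u * b"

definition corner_gram :: "'a::unital_cstar_algebra \<Rightarrow> 'a \<Rightarrow> 'a \<Rightarrow> 'a" where
  "corner_gram u p b = corner_idem u p b * adj (corner_idem u p b) + (1 - p)"

text \<open>For the idempotent \<open>E\<close>, the right support is \<open>adj E\<close> times the
  inverse of \<open>E * adj E\<close> in \<open>p A p\<close> times \<open>E\<close>. The summand
  \<open>1 - p\<close> in \<open>corner_gram\<close> turns that into an inverse in the whole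
  algebra.\<close>

definition corner_support :: "'a::unital_cstar_algebra \<Rightarrow> 'a \<Rightarrow> 'a \<Rightarrow> 'a" where
  "corner_support u p b
    = adj (corner_idem u p b) * inv_elt (corner_gram u p b) * corner_idem u p b"

lemma right_support_corner_support:
  fixes b :: "'a::unital_cstar_algebra"
  assumes p: "is_projection p" and u: "adj u * u = p"
    and c: "\<And>x. (1 - u * adj u) * x * (1 - p) = 0"
    and iG: "two_sided_invertible (corner u p b)" and iN: "two_sided_invertible (corner_gram u p b)"
  shows "right_support b (corner_support u p b)"
proof -
  note pp = is_projectionD[OF p] and pu = partial_isometry[OF p u]
  define G E N where "G = corner u p b" and "E = corner_idem u p b" and "N = corner_gram u p b"
  define G' N' where "G' = inv_elt G" and "N' = inv_elt N"
  have pu': "p * (adj u * x) = adj u * x" for x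
    using pu by (simp flip: mult.assoc)
  have uu: "adj u * (u * x) = p * x" for x
    using u by (simp flip: mult.assoc)
  have pG: "p * G = adj u * (b * p)" "G * p = adj u * (b * p)"
    by (simp_all add: G_def corner_def algebra_simps pp pu')
  have G': "G' * (G * x) = x" "G * (G' * x) = x" "p * G' = G' * p" for x
    using inv_elt_cancel[of G] inv_elt_commute[of G p] iG pG by (simp_all add: G_def G'_def)
  have E: "E = G' * (adj u * b)"
    by (simp add: E_def corner_idem_def G'_def G_def mult.assoc)
  \<comment> \<open>Together with \<open>p * E = E\<close> this makes \<open>E\<close> an idempotent
    with the same left range as \<open>p\<close>.\<close>
  have Ep: "E * p = p"
  proof -
    have "E * p = G' * (G * p)"
      by (simp add: E pG mult.assoc)
    then show ?thesis by (simp add: G')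
  qed
  have pE: "p * E = E"
  proof -
    have "p * E = (p * G') * (adj u * b)"
      by (simp add: E mult.assoc)
    also have "\<dots> = E"
      by (simp add: G' E mult.assoc pu')
    finally show ?thesis .
  qed
  have EE: "E * E = E"
    by (metis Ep pE mult.assoc)
  have bE: "b * E = b"
  proof -
    \<comment> \<open>The Schur complement term: it is annihilated by \<open>p\<close> on the right
      and by \<open>adj u\<close> on the left, so it lies in the corner assumed to vanish.\<close>
    define r where "r = b - b * E"
    have "r * p = 0"
      by (simp add: r_def left_diff_distrib mult.assoc Ep)
    moreover have "adj u * r = 0"
    proof -
      have "adj u * (b * E) = adj u * (b * (p * E))"
        by (simp add: pE)
      also have "\<dots> = (G * p) * E"
        by (simp add: pG mult.assoc)
      also have "\<dots> = G * (G' * (adj u * b))"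
        by (simp add: mult.assoc pE) (simp add: E)
      also have "\<dots> = adj u * b"
        by (simp add: G')
      finally show ?thesis
        by (simp add: r_def right_diff_distrib)
    qed
    ultimately have "r = (1 - u * adj u) * r * (1 - p)"
      by (simp add: algebra_simps)
    then have "r = 0"
      using c by simp
    then show ?thesis by (simp add: r_def)
  qed
  have aE: "p * adj E = p" "adj E * p = adj E"
    using arg_cong[OF Ep, of adj] arg_cong[OF pE, of adj] by (simp_all add: pp)
  have N: "N = E * adj E + (1 - p)"
    by (simp add: N_def corner_gram_def E_def)
  have pN: "p * N = E * adj E" "N * p = E * adj E"
    by (simp_all add: N algebra_simps pp aE) (simp add: pE flip: mult.assoc)
  have N': "N' * N = 1" "N * N' = 1" "N' * p = p * N'" "adj N' = N'"
    using inv_elt[of N] inv_elt_commute[of N p] inv_elt_adj(2)[of N] iN pN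
    by (simp_all add: N_def[symmetric] N'_def) (simp add: N pp)
  define s where "s = adj E * N' * E"
  have "E * s = (E * adj E) * N' * E"
    by (simp add: s_def mult.assoc)
  also have "\<dots> = p * (N * N') * E"
    by (simp add: pN(1)[symmetric] mult.assoc)
  also have "\<dots> = E"
    by (simp add: N' pE)
  finally have Es: "E * s = E" .
  have "s * s = adj E * N' * (E * s)"
    by (simp add: s_def mult.assoc)
  then have "s * s = s"
    by (simp only: Es) (simp add: s_def)
  moreover have "adj s = s"
    by (simp add: s_def N' mult.assoc)
  ultimately have "is_projection s"
    by (simp add: is_projection_def)
  moreover have "b * s = b"
    by (metis Es bE mult.assoc)
  moreover have "s = (adj E * N' * (G' * adj u)) * b"
    by (simp add: s_def E mult.assoc)
  ultimately show ?thesis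
    unfolding right_support_def s_def corner_support_def E_def N_def N'_def by blast
qed

text \<open>At \<open>b = a\<close> the four expressions \<open>corner\<close>,
  \<open>corner_idem\<close>, \<open>corner_gram\<close> and \<open>corner_support\<close> take the
  values \<open>abs_element a + (1 - p)\<close>, \<open>p\<close>, \<open>1\<close> and
  \<open>p\<close>. The elements to be inverted are invertible there, so continuity of inversion
  carries the limits through.\<close>

lemma corner_support_tendsto:
  fixes f :: "'b \<Rightarrow> 'a::unital_cstar_algebra"
  assumes f: "(f \<longlongrightarrow> a) F" and ap: "right_support a p" and u_def: "u = polar_part a"
  shows "((\<lambda>b. corner_support u p (f b)) \<longlongrightarrow> p) F"
    and "eventually (\<lambda>b. two_sided_invertible (corner u p (f b))) F"
    and "eventually (\<lambda>b. two_sided_invertible (corner_gram u p (f b))) F"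
proof -
  define k where "k = abs_element a"
  define g where "g = k + (1 - p)"
  have p: "is_projection p"
    by (rule support_projection[OF ap])
  note pp = is_projectionD[OF p]
  have k: "k * p = k" "p * k = k"
    by (simp_all add: k_def abs_element_support[OF ap])
  have "adj u * a = adj u * u * k"
    using polar_part_mult_abs[OF ap] by (simp add: u_def k_def mult.assoc)
  also have "adj u * u = p"
    unfolding u_def by (rule adj_polar_part_mult[OF ap])
  finally have ua: "adj u * a = k"
    by (simp add: k)
  have ca: "corner u p a = g"
    by (simp add: corner_def ua k g_def)
  have ig: "two_sided_invertible g"
    unfolding g_def k_def by (rule two_sided_invertible_abs_support[OF ap])
  have "((\<lambda>b. corner u p (f b)) \<longlongrightarrow> corner u p a) F"
    unfolding corner_def by (intro tendsto_intros f)
  note G = tendsto_inv_elt[OF this[unfolded ca] ig]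
  show "eventually (\<lambda>b. two_sided_invertible (corner u p (f b))) F"
    by (rule G(1))
  have "inv_elt g * adj u * a = inv_elt g * (g * p)"
    by (simp add: mult.assoc ua g_def algebra_simps k pp)
  then have "inv_elt g * adj u * a = p"
    by (simp only: inv_elt_cancel[OF ig])
  moreover have "((\<lambda>b. corner_idem u p (f b)) \<longlongrightarrow> inv_elt g * adj u * a) F"
    unfolding corner_idem_def by (intro tendsto_intros f G(2))
  ultimately have E: "((\<lambda>b. corner_idem u p (f b)) \<longlongrightarrow> p) F"
    by (simp only:)
  have "((\<lambda>b. corner_gram u p (f b)) \<longlongrightarrow> p * adj p + (1 - p)) F"
    unfolding corner_gram_def by (intro tendsto_intros E)
  then have N: "((\<lambda>b. corner_gram u p (f b)) \<longlongrightarrow> 1) F"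
    by (simp add: pp)
  note N' = tendsto_inv_elt[OF N two_sided_invertible_1]
  show "eventually (\<lambda>b. two_sided_invertible (corner_gram u p (f b))) F"
    by (rule N'(1))
  have "inv_elt 1 = (1 :: 'a)"
    by (rule inv_elt_eqI) simp_all
  moreover have "((\<lambda>b. corner_support u p (f b)) \<longlongrightarrow> adj p * inv_elt 1 * p) F"
    unfolding corner_support_def by (intro tendsto_intros E N'(2))
  ultimately show "((\<lambda>b. corner_support u p (f b)) \<longlongrightarrow> p) F"
    by (simp add: pp)
qed

text \<open>Once \<open>f b\<close> has the support \<open>corner_support u p (f b)\<close>, its
  polar part is given by \<open>polar_part_eq\<close>, an expression in which every ingredient
  converges.\<close>

lemma closed_range_near_of_corner_zero:
  fixes f :: "'b \<Rightarrow> 'a::unital_cstar_algebra"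
  assumes f: "(f \<longlongrightarrow> a) F" and ap: "right_support a p"
    and c: "\<And>x. (1 - polar_part a * adj (polar_part a)) * x * (1 - p) = 0"
  shows "eventually (\<lambda>b. closed_range (f b)) F" "((\<lambda>b. polar_part (f b)) \<longlongrightarrow> polar_part a) F"
proof -
  define u where "u = polar_part a"
  note lim = corner_support_tendsto[OF f ap u_def]
  have ev: "eventually (\<lambda>b. right_support (f b) (corner_support u p (f b))) F"
    using lim(2,3)
  proof eventually_elim
    case (elim b)
    show ?case
      by (rule right_support_corner_support[OF support_projection[OF ap] _ _ elim])
        (use c in \<open>simp_all add: u_def adj_polar_part_mult[OF ap]\<close>)
  qed
  then show "eventually (\<lambda>b. closed_range (f b)) F"
    by eventually_elim (rule right_support_imp_closed_range)
  have "((\<lambda>b. abs_element (f b) + (1 - corner_support u p (f b))) \<longlongrightarrow> abs_element a + (1 - p)) F"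
    by (intro tendsto_intros tendsto_abs_element f lim(1))
  note inv = tendsto_inv_elt(2)[OF this two_sided_invertible_abs_support[OF ap]]
  have "((\<lambda>b. f b * inv_elt (abs_element (f b) + (1 - corner_support u p (f b)))) \<longlongrightarrow> polar_part a) F"
    unfolding polar_part_eq[OF ap] by (intro tendsto_intros f inv)
  then show "((\<lambda>b. polar_part (f b)) \<longlongrightarrow> polar_part a) F"
    by (rule Lim_transform_eventually)
      (use ev in eventually_elim, simp add: polar_part_eq)
qed

section \<open>Failure of stability at other elements\<close>

text \<open>
  For \<open>y\<close> in the corner, \<open>|a + t y| = |a| + t |y|\<close>, so \<open>y = u(a + t y) |y|\<close> for every
  \<open>t > 0\<close>; the limit \<open>t \<rightarrow> 0\<close> gives \<open>y = u |y|\<close>, which lies in \<open>u u\<^sup>* A\<close>.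
\<close>

lemma corner_zero_of_continuous:
  fixes a :: "'a::unital_cstar_algebra"
  assumes ap: "right_support a p"
    and cont: "continuous (at a within {b. closed_range b}) polar_part"
    and int: "a \<in> interior {b. closed_range b}"
  shows "(1 - polar_part a * adj (polar_part a)) * x * (1 - p) = 0"
proof -
  define u k where "u = polar_part a" and "k = abs_element a"
  define y where "y = (1 - u * adj u) * x * (1 - p)"
  define l where "l = abs_element y"
  have p: "is_projection p"
    by (rule support_projection[OF ap])
  note pp = is_projectionD[OF p]
  have uu: "adj u * u = p"
    unfolding u_def by (rule adj_polar_part_mult[OF ap])
  note pu = partial_isometry[OF p uu]
  have uk: "u * k = a"
    unfolding u_def k_def by (rule polar_part_mult_abs[OF ap])
  have k: "k * p = k" "p * k = k"
    by (simp_all add: k_def abs_element_support[OF ap])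
  have "adj u * (1 - u * adj u) = 0"
    by (simp add: right_diff_distrib uu pu flip: mult.assoc)
  then have uy: "adj u * y = 0"
    by (simp add: y_def flip: mult.assoc)
  have yp: "y * p = 0"
    by (simp add: y_def left_diff_distrib mult.assoc pp)
  have ay: "adj a * y = 0"
    by (simp add: uk[symmetric] mult.assoc uy)
  have ya: "adj y * a = 0"
    using arg_cong[OF ay, of adj] by simp
  have lp: "l * p = 0"
    unfolding l_def abs_element_mult_eq_0_iff by (rule yp)
  have lk: "l * k = 0"
    by (metis k(2) lp mult.assoc mult_zero_left)
  have kl: "k * l = 0"
    using arg_cong[OF lk, of adj] by (simp add: k_def l_def)
  have abs: "abs_element (a + t *\<^sub>R y) = k + t *\<^sub>R l" if "t > 0" for t
  proof (rule abs_element_eqI)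
    show "pos (k + t *\<^sub>R l)"
      using that unfolding k_def l_def by (intro pos_add pos_scaleR pos_abs_element) auto
    have "k * k = adj a * a" "l * l = adj y * y"
      by (simp_all add: k_def l_def abs_element_square)
    then show "(k + t *\<^sub>R l) * (k + t *\<^sub>R l) = adj (a + t *\<^sub>R y) * (a + t *\<^sub>R y)"
      by (simp add: algebra_simps lk kl ay ya)
  qed
  have lim: "((\<lambda>t. a + t *\<^sub>R y) \<longlongrightarrow> a) (at_right 0)"
  proof -
    have "((\<lambda>t. a + t *\<^sub>R y) \<longlongrightarrow> a + 0 *\<^sub>R y) (at_right 0)"
      by (intro tendsto_intros)
    then show ?thesis by simp
  qed
  \<comment> \<open>Interiority puts the ray from \<open>a\<close> in direction \<open>y\<close>
    into the domain for small \<open>t\<close>, where continuity within the domain can be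
    applied.\<close>
  have "eventually (\<lambda>t. a + t *\<^sub>R y \<in> interior {b. closed_range b}) (at_right 0)"
    by (rule topological_tendstoD[OF lim open_interior int])
  then have ev: "eventually (\<lambda>t. a + t *\<^sub>R y \<in> {b. closed_range b}) (at_right 0)"
    by eventually_elim (use interior_subset in blast)
  have ev2: "eventually (\<lambda>t. polar_part (a + t *\<^sub>R y) * l = y) (at_right 0)"
    using ev eventually_at_right_less[of "0::real"]
  proof eventually_elim
    case (elim t)
    define v where "v = polar_part (a + t *\<^sub>R y)"
    obtain r where "right_support (a + t *\<^sub>R y) r"
      using elim closed_range_imp_right_support by auto
    then have "v * (k + t *\<^sub>R l) = a + t *\<^sub>R y"
      unfolding abs[OF elim(2), symmetric] v_def by (rule polar_part_mult_abs)
    \<comment> \<open>Multiplication by \<open>1 - p\<close> removes \<open>k\<close> and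
      \<open>a\<close> and keeps \<open>l\<close> and \<open>y\<close>; the factor \<open>t\<close>
      then cancels.\<close>
    then have "v * (k + t *\<^sub>R l) * (1 - p) = (a + t *\<^sub>R y) * (1 - p)"
      by simp
    moreover have "v * (k + t *\<^sub>R l) * (1 - p) = t *\<^sub>R (v * l)"
      by (simp add: mult.assoc) (simp add: algebra_simps k lp)
    moreover have "a * p = a"
      using ap by (simp add: right_support_def)
    then have "(a + t *\<^sub>R y) * (1 - p) = t *\<^sub>R y"
      by (simp add: algebra_simps yp)
    ultimately show ?case
      using elim(2) by (simp add: v_def)
  qed
  have "((\<lambda>t. polar_part (a + t *\<^sub>R y)) \<longlongrightarrow> u) (at_right 0)"
    unfolding u_def by (rule continuous_within_tendsto_compose[OF cont ev lim])
  then have "((\<lambda>t. polar_part (a + t *\<^sub>R y) * l) \<longlongrightarrow> u * l) (at_right 0)"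
    by (intro tendsto_intros)
  then have "((\<lambda>t. y) \<longlongrightarrow> u * l) (at_right (0::real))"
    by (rule Lim_transform_eventually[OF _ ev2])
  then have y: "y = u * l"
    by (simp add: tendsto_const_iff)
  \<comment> \<open>Now \<open>u * l = u * p * l = 0\<close>, since \<open>u\<close> lives on
    \<open>p\<close> and \<open>l\<close> off it.\<close>
  have "p * l = 0"
    using arg_cong[OF lp, of adj] pp by (simp add: l_def)
  then have "y = 0"
    using uy pu(1) unfolding y by (metis mult.assoc mult_zero_right)
  then show ?thesis
    by (simp add: y_def u_def)
qed

theorem mainTheorem6:
  fixes a :: "'a::unital_cstar_algebra"
  assumes "closed_range a"
  shows "continuous (at a within {b. closed_range b}) polar_part \<and> a \<in> interior {b. closed_range b}
    \<longleftrightarrow> quasi_invertible a"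
proof -
  obtain p where ap: "right_support a p"
    using closed_range_imp_right_support[OF assms] .
  have q: "quasi_invertible a \<longleftrightarrow>
      (\<forall>x. (1 - polar_part a * adj (polar_part a)) * x * (1 - p) = 0)"
    using extreme_point_iff_corner_zero[OF support_projection[OF ap] adj_polar_part_mult[OF ap]] assms
    by (simp add: quasi_invertible_def)
  show ?thesis
  proof
    assume "continuous (at a within {b. closed_range b}) polar_part \<and> a \<in> interior {b. closed_range b}"
    then show "quasi_invertible a"
      unfolding q using corner_zero_of_continuous[OF ap] by blast
  next
    assume "quasi_invertible a"
    then have c: "(1 - polar_part a * adj (polar_part a)) * x * (1 - p) = 0" for x
      using q by blast
    \<comment> \<open>The identity map along the neighbourhood filter of \<open>a\<close> gives
      interiority and continuity at once.\<close>
    note near = closed_range_near_of_corner_zero[OF filterlim_ident ap c]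
    have "continuous (at a within {b. closed_range b}) polar_part"
      unfolding continuous_within by (rule tendsto_mono[OF at_within_le_nhds near(2)])
    moreover have "a \<in> interior {b. closed_range b}"
      using near(1) unfolding eventually_nhds interior_def by blast
    ultimately show "continuous (at a within {b. closed_range b}) polar_part
        \<and> a \<in> interior {b. closed_range b}"
      by blast
  qed
qed

end
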